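(* Let $\mathcal{M}$ be a finite set of positive integers with $24 \mid m$ for every $m\in\mathcal{M}$, let $\delta:\mathcal{M}\to\mathbb{Z}$, $m\mapsto\delta_m$, and let $k$ be a positive integer. With the notation of the context, put $$c=\tfrac12\sum_{m:\,2\nmid k_m}\delta_m(k_m-3)+\sum_{m\in\mathcal{M}}\delta_m\left(\frac{(-1)^{k_m}m_k}{k'_m}\right),\qquad \chi(h)=\prod_{m:\,2\nmid\delta_m}\left(\frac{h}{k'_m}\right).$$ Then for every integer $n$, $$A_k(n)=i^{c}\,\psi(1)\sum_{\substack{0\le h<k\\ \gcd(h,k)=1}}\chi(h)\rho(h)\exp\!\left(\frac{2\pi i}{k}\big((a-n)h+b\overline{h}\big)\right),$$ where $\overline h$ denotes an inverse of $h$ modulo $k$; i.e. $A_k(n)=i^c\psi(1)S_{\chi\rho}(a-n,b;k)$.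
   Context: Dedekind sums: for integers $a,b$ with $b>0$, $s(a,b)=\sum_{j=0}^{b-1}((j/b))((aj/b))$, where $((x))=x-\lfloor x\rfloor-1/2$ if $x\notin\mathbb{Z}$ and $((x))=0$ otherwise. HRR coefficients: for integers $k\ge1$ and $n$, $$A_k(n)=\sum_{\substack{0\le h<k\\ \gcd(h,k)=1}}\exp\!\Big(-2\pi i\Big(\tfrac{hn}{k}+\tfrac12\sum_{m\in\mathcal{M}}\delta_m\, s\big(\tfrac{mh}{\gcd(m,k)},\tfrac{k}{\gcd(m,k)}\big)\Big)\Big).$$ Twisted Kloosterman sum: for a function $\phi$ on integers coprime to $k$ depending only on the residue mod $k$, $S_\phi(a,b;k)=\sum_{0\le h<k,\,\gcd(h,k)=1}\phi(h)\exp(2\pi i(ah+b\overline h)/k)$. $\left(\frac{\cdot}{\cdot}\right)$ denotes the Jacobi symbol (with $\left(\frac{x}{1}\right)=1$). Notation (for fixed $k$): $\lambda=\operatorname{val}_2(k)$; for $m\in\mathcal{M}$: $k_m=k/\gcd(m,k)$, $m_k=m/\gcd(m,k)$, $\lambda_m=\operatorname{val}_2(k_m)$, $k'_m=k_m/2^{\lambda_m}$; $u_m=1$ if $3\mid k_m$, and otherwise $u_m$ is an integer with $u_m\equiv1\pmod{k_m}$, $u_m\equiv0\pmod 3$; $v_m$ is an inverse of $m_k$ modulo $\gcd(3,k_m)k_m$; for $m$ with $2\mid k_m$, $w_m$ is an inverse of $m_k$ modulo $2^{3+\lambda}$. Set $a_1=-\sum_m\delta_m u_m m$, $b_1=-\sum_m\delta_m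 u_m v_m\gcd(m,k)$, $a_2=-\sum_{m:\,2\mid k_m}\delta_m m$, $b_2=-\sum_{m:\,2\mid k_m}\delta_m w_m\gcd(m,k)(k_m^2+3k_m+1)$. Let $t_1,t_2$ be integers with $t_1\equiv1\pmod{3k/2^\lambda}$, $t_1\equiv0\pmod{2^{3+\lambda}}$, $t_2\equiv1\pmod{2^{3+\lambda}}$, $t_2\equiv0\pmod{3k/2^\lambda}$. Then $t_1a_1+t_2a_2$ and $t_1b_1+t_2b_2$ are divisible by $24$, and $a=(t_1a_1+t_2a_2)/24$, $b=(t_1b_1+t_2b_2)/24$ (well defined modulo $k$). For odd $h$ define $$\psi(h)=\prod_{\substack{m:\,2\nmid\delta_m,\,2\mid k_m,\\ k'_m\equiv1\ (4)}}(-1)^{\frac{hm_k-1}{2}}\cdot\prod_{\substack{m:\,2\nmid\delta_m,\,2\mid k_m,\\ 2\nmid\lambda_m}}(-1)^{\frac{(hm_k)^2-1}{8}},$$ and $\rho(h)=\psi(1)\psi(h)$ (a character modulo $8$; if $k$ is odd then $\psi\equiv\rho\equiv1$). *)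

theory Defs
  imports Complex_Main "HOL-Number_Theory.Number_Theory"
begin

definition sawtooth :: "real \<Rightarrow> real" where
  "sawtooth x = (if x \<in> \<int> then 0 else x - of_int \<lfloor>x\<rfloor> - 1/2)"

definition dedekind_sum :: "int \<Rightarrow> int \<Rightarrow> real" where
  "dedekind_sum a b =
     (\<Sum>j\<in>{0..<b}. sawtooth (of_int j / of_int b) * sawtooth (of_int (a * j) / of_int b))"

text \<open>The Jacobi symbol, for odd positive \<open>n\<close>; prime factors are taken with multiplicity.\<close>
definition jacobi :: "int \<Rightarrow> int \<Rightarrow> int" where
  "jacobi a n = prod_mset (image_mset (Legendre a) (prime_factorization n))"

definition reduced_residues :: "int \<Rightarrow> int set" where
  "reduced_residues k = {h. 0 \<le> h \<and> h < k \<and> coprime h k}"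

definition hrr_coeff :: "int set \<Rightarrow> (int \<Rightarrow> int) \<Rightarrow> int \<Rightarrow> int \<Rightarrow> complex" where
  "hrr_coeff M \<delta> k n =
     (\<Sum>h\<in>reduced_residues k.
        exp (- 2 * of_real pi * \<i> *
          of_real (of_int (h * n) / of_int k
            + 1/2 * (\<Sum>m\<in>M. of_int (\<delta> m) *
                dedekind_sum ((m * h) div gcd m k) (k div gcd m k)))))"

text \<open>
  For \<open>\<phi>\<close> depending only on residues modulo \<open>k\<close>. The value does not depend on the choice
  of the inverse of \<open>h\<close> modulo \<open>k\<close>.
\<close>
definition twisted_kloosterman :: "(int \<Rightarrow> complex) \<Rightarrow> int \<Rightarrow> int \<Rightarrow> int \<Rightarrow> complex" where
  "twisted_kloosterman \<phi> a b k =
     (\<Sum>h\<in>reduced_residues k.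
        \<phi> h * exp (2 * of_real pi * \<i> * of_int (a * h + b * modular_inverse k h) / of_int k))"

text \<open>
  In the following names, \<open>k_sub k m\<close> is $k_m$, \<open>m_sub k m\<close> is $m_k$, \<open>lam_sub k m\<close> is
  $\lambda_m$ and \<open>k_odd k m\<close> is $k'_m$ (the odd part of $k_m$).
\<close>
definition k_sub :: "int \<Rightarrow> int \<Rightarrow> int" where
  "k_sub k m = k div gcd m k"

definition m_sub :: "int \<Rightarrow> int \<Rightarrow> int" where
  "m_sub k m = m div gcd m k"

definition lam_sub :: "int \<Rightarrow> int \<Rightarrow> nat" where
  "lam_sub k m = multiplicity 2 (k_sub k m)"

definition k_odd :: "int \<Rightarrow> int \<Rightarrow> int" where
  "k_odd k m = k_sub k m div 2 ^ lam_sub k m"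

definition coeff_a1 :: "int set \<Rightarrow> (int \<Rightarrow> int) \<Rightarrow> (int \<Rightarrow> int) \<Rightarrow> int" where
  "coeff_a1 M \<delta> u = - (\<Sum>m\<in>M. \<delta> m * u m * m)"

definition coeff_b1 ::
    "int set \<Rightarrow> (int \<Rightarrow> int) \<Rightarrow> int \<Rightarrow> (int \<Rightarrow> int) \<Rightarrow> (int \<Rightarrow> int) \<Rightarrow> int" where
  "coeff_b1 M \<delta> k u v = - (\<Sum>m\<in>M. \<delta> m * u m * v m * gcd m k)"

definition coeff_a2 :: "int set \<Rightarrow> (int \<Rightarrow> int) \<Rightarrow> int \<Rightarrow> int" where
  "coeff_a2 M \<delta> k = - (\<Sum>m\<in>{m\<in>M. even (k_sub k m)}. \<delta> m * m)"

definition coeff_b2 :: "int set \<Rightarrow> (int \<Rightarrow> int) \<Rightarrow> int \<Rightarrow> (int \<Rightarrow> int) \<Rightarrow> int" where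
  "coeff_b2 M \<delta> k w =
     - (\<Sum>m\<in>{m\<in>M. even (k_sub k m)}.
          \<delta> m * w m * gcd m k * ((k_sub k m)\<^sup>2 + 3 * k_sub k m + 1))"

text \<open>
  Used for \<open>h\<close> coprime to \<open>k\<close>. If either product is nonempty, then \<open>k\<close> is even, so \<open>h\<close> is odd,
  and so is \<open>m_sub k m\<close> for every index \<open>m\<close>; hence both divisions are exact.
\<close>
definition psi :: "int set \<Rightarrow> (int \<Rightarrow> int) \<Rightarrow> int \<Rightarrow> int \<Rightarrow> complex" where
  "psi M \<delta> k h =
     (\<Prod>m\<in>{m\<in>M. odd (\<delta> m) \<and> even (k_sub k m) \<and> [k_odd k m = 1] (mod 4)}.
        (-1) powi ((h * m_sub k m - 1) div 2)) *
     (\<Prod>m\<in>{m\<in>M. odd (\<delta> m) \<and> even (k_sub k m) \<and> odd (lam_sub k m)}.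
        (-1) powi (((h * m_sub k m)\<^sup>2 - 1) div 8))"

definition rho :: "int set \<Rightarrow> (int \<Rightarrow> int) \<Rightarrow> int \<Rightarrow> int \<Rightarrow> complex" where
  "rho M \<delta> k h = psi M \<delta> k 1 * psi M \<delta> k h"

definition chi :: "int set \<Rightarrow> (int \<Rightarrow> int) \<Rightarrow> int \<Rightarrow> int \<Rightarrow> complex" where
  "chi M \<delta> k h = (\<Prod>m\<in>{m\<in>M. odd (\<delta> m)}. of_int (jacobi h (k_odd k m)))"

text \<open>The first sum is even, since \<open>k_sub k m - 3\<close> is even for every index \<open>m\<close>.\<close>
definition c_exp :: "int set \<Rightarrow> (int \<Rightarrow> int) \<Rightarrow> int \<Rightarrow> int" where
  "c_exp M \<delta> k =
     (\<Sum>m\<in>{m\<in>M. odd (k_sub k m)}. \<delta> m * (k_sub k m - 3)) div 2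
     + (\<Sum>m\<in>M. \<delta> m * jacobi ((-1) ^ nat (k_sub k m) * m_sub k m) (k_odd k m))"

end

theory Submission
  imports Defs
begin

text \<open>
  The identity holds term by term in \<open>h\<close>. The integer \<open>12 k s(h, k)\<close> is known modulo
  \<open>gcd(3, k) k\<close> (compare \<open>\<Sum> (h j mod k)\<^sup>2\<close> with \<open>\<Sum> j\<^sup>2\<close>); modulo \<open>8\<close> for odd \<open>k\<close> it equals
  \<open>k + 1\<close> minus twice the Jacobi symbol of \<open>h\<close> over \<open>k\<close>, because both sides obey the same
  Euclidean recursion, by the reciprocity laws for Dedekind sums and for Jacobi symbols; one more
  application of reciprocity treats even \<open>k\<close>. Since \<open>24 k\<close> is the product of the coprime moduli
  \<open>3 k / 2\<^sup>\<lambda>\<close> and \<open>2\<^sup>3\<^sup>+\<^sup>\<lambda>\<close>, the numbers \<open>t\<^sub>1\<close> and \<open>t\<^sub>2\<close> glue these congruences together: what is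
  linear in \<open>h\<close> and its inverse gives \<open>a\<close> and \<open>b\<close>, and what remains is a fourth root of unity.
\<close>

section \<open>The Jacobi symbol\<close>

lemma Legendre_cong:
  assumes "[a = b] (mod p)"
  shows "Legendre a p = Legendre b p"
proof -
  have "[c = a] (mod p) \<longleftrightarrow> [c = b] (mod p)" for c
    using assms by (metis cong_sym cong_trans)
  moreover have "[a = 0] (mod p) \<longleftrightarrow> [b = 0] (mod p)"
    using assms by (metis cong_sym cong_trans)
  ultimately show ?thesis by (simp add: Legendre_def QuadRes_def)
qed

lemma Legendre_values: "Legendre a p \<in> {-1, 0, 1}"
  by (simp add: Legendre_def)

text \<open>Two elements of {-1, 0, 1} differ by at most 2, so a modulus above 2 separates them.
  This turns congruences from Euler's criterion into equalities.\<close>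

lemma Legendre_eqI:
  assumes "[x = y] (mod p)" "x \<in> {-1, 0, 1}" "y \<in> {-1, 0, 1}" "2 < p"
  shows "x = (y::int)"
proof -
  have "p dvd x - y" using assms(1) by (simp add: cong_iff_dvd_diff)
  moreover have "\<bar>x - y\<bar> \<le> 2" using assms(2,3) by auto
  ultimately show ?thesis
    using assms(4) dvd_imp_le_int[of "x - y" p] by fastforce
qed

lemma Legendre_euler:
  assumes "prime p" "2 < p"
  shows "[Legendre a p = a ^ ((nat p - 1) div 2)] (mod p)"
  using euler_criterion[of "nat p" a] assms by simp

lemma Legendre_mult:
  assumes "prime p" "2 < p"
  shows "Legendre (a * b) p = Legendre a p * Legendre b p"
proof (rule Legendre_eqI[OF _ _ _ assms(2)])
  have "[Legendre a p * Legendre b p = a ^ ((nat p - 1) div 2) * b ^ ((nat p - 1) div 2)] (mod p)"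
    using Legendre_euler[OF assms] by (intro cong_mult)
  then show "[Legendre (a * b) p = Legendre a p * Legendre b p] (mod p)"
    using Legendre_euler[OF assms, of "a * b"] by (metis power_mult_distrib cong_sym cong_trans)
  show "Legendre a p * Legendre b p \<in> {-1, 0, 1}"
    using Legendre_values[of a p] Legendre_values[of b p] by auto
qed (rule Legendre_values)

lemma Legendre_one:
  assumes "prime p" "2 < p"
  shows "Legendre 1 p = 1"
  by (rule Legendre_eqI[OF _ Legendre_values _ assms(2)])
    (use Legendre_euler[OF assms, of 1] in auto)

text \<open>Writing odd numbers as \<open>2 * p + 1\<close> reduces every sign condition modulo 4
  below to a parity.\<close>

lemma cong_3_mod_4_iff: "[2 * p + 1 = 3] (mod 4) \<longleftrightarrow> odd p" for p :: int
  by (auto simp: cong_iff_dvd_diff elim!: evenE oddE) presburger+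

lemma Legendre_minus_one:
  assumes "prime p" "2 < p"
  shows "Legendre (-1) p = (if [p = 3] (mod 4) then -1 else 1)"
proof (rule Legendre_eqI[OF _ Legendre_values _ assms(2)])
  have "odd p" using assms prime_odd_int by auto
  define e where "e = (nat p - 1) div 2"
  have "p = 2 * int e + 1" using \<open>odd p\<close> assms(2) unfolding e_def by (auto elim!: oddE)
  then have "(-1) ^ e = (if [p = 3] (mod 4) then -1 else (1::int))"
    using cong_3_mod_4_iff[of "int e"] by (simp add: minus_one_power_iff)
  then show "[Legendre (-1) p = (if [p = 3] (mod 4) then -1 else 1)] (mod p)"
    using Legendre_euler[OF assms, of "-1"] by (simp add: e_def)
qed auto

lemma jacobi_one_right [simp]: "jacobi a 1 = 1"
  by (simp add: jacobi_def)

lemma jacobi_times_prime: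
  assumes "prime p" "n \<noteq> 0"
  shows "jacobi a (p * n) = Legendre a p * jacobi a n"
  using assms by (simp add: jacobi_def prime_factorization_mult prime_factorization_prime)

text \<open>Peels off one odd prime at a time. Since \<open>jacobi\<close> is a product over prime
  factors, its laws thereby reduce to those of the Legendre symbol.\<close>

lemma odd_pos_induct [consumes 2, case_names one factor]:
  fixes n :: int
  assumes "odd n" "0 < n"
    and one: "P 1"
    and factor: "\<And>p n. prime p \<Longrightarrow> 2 < p \<Longrightarrow> odd p \<Longrightarrow> odd n \<Longrightarrow> 0 < n \<Longrightarrow> P n \<Longrightarrow> P (p * n)"
  shows "P n"
  using assms(1,2)
proof (induction n rule: prime_divisors_induct)
  case (unit x)
  then show ?case using one by (auto simp: zdvd1_eq abs_if split: if_splits)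
next
  case (factor p x)
  have "0 < p" using \<open>prime p\<close> prime_gt_0_int by blast
  moreover have "p \<noteq> 2" using factor.prems by auto
  moreover have "2 \<le> p" using \<open>prime p\<close> prime_ge_2_int by blast
  ultimately show ?case
    using factor assms(4)[of p x] by (auto simp: zero_less_mult_iff)
qed auto

lemma jacobi_mult_left:
  assumes "odd n" "0 < n"
  shows "jacobi (a * b) n = jacobi a n * jacobi b n"
  using assms by (induction n rule: odd_pos_induct)
    (simp_all add: jacobi_times_prime Legendre_mult)

lemma jacobi_cong:
  assumes "[a = b] (mod n)"
  shows "jacobi a n = jacobi b n"
proof -
  have "Legendre a p = Legendre b p" if "p \<in># prime_factorization n" for p
    using that assms by (intro Legendre_cong) (metis cong_dvd_modulus in_prime_factors_imp_dvd)
  then show ?thesis unfolding jacobi_def by (metis image_mset_cong)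
qed

lemma jacobi_one_left:
  assumes "odd n" "0 < n"
  shows "jacobi 1 n = 1"
  using assms by (induction n rule: odd_pos_induct)
    (simp_all add: jacobi_times_prime Legendre_one)

lemma jacobi_coprime:
  assumes "odd n" "0 < n" "coprime a n"
  shows "jacobi a n = 1 \<or> jacobi a n = -1"
  using assms
proof (induction n rule: odd_pos_induct)
  case (factor p n)
  then have "Legendre a p = 1 \<or> Legendre a p = -1"
    by (auto simp: Legendre_def cong_0_iff)
  with factor show ?case by (auto simp: jacobi_times_prime)
qed simp

lemma odd_mod_4: "odd n \<Longrightarrow> n mod 4 = 1 \<or> n mod 4 = 3" for n :: int
  by presburger

lemma odd_mod_8: "odd n \<Longrightarrow> n mod 8 = 1 \<or> n mod 8 = 3 \<or> n mod 8 = 5 \<or> n mod 8 = 7" for n :: int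
  by presburger

text \<open>The odd classes modulo 4 form a group of order 2, so membership in the class of 3
  combines by exclusive or.\<close>

lemma cong_3_mod_4_mult:
  assumes "odd m" "odd (n::int)"
  shows "[m * n = 3] (mod 4) \<longleftrightarrow> [m = 3] (mod 4) \<noteq> [n = 3] (mod 4)"
  using odd_mod_4[OF assms(1)] odd_mod_4[OF assms(2)]
  unfolding cong_def by (subst mod_mult_eq[symmetric]) auto

lemma jacobi_minus_one:
  assumes "odd n" "0 < n"
  shows "jacobi (-1) n = (if [n = 3] (mod 4) then -1 else 1)"
  using assms
proof (induction n rule: odd_pos_induct)
  case one
  then show ?case by (simp add: cong_def)
next
  case (factor p n)
  then show ?case
    by (simp add: jacobi_times_prime Legendre_minus_one cong_3_mod_4_mult)
qed

section \<open>Quadratic reciprocity and the value at 2\<close>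

lemma Legendre_reciprocity:
  assumes "prime p" "2 < p" "prime q" "2 < q" "p \<noteq> q"
  shows "Legendre p q * Legendre q p = (if [p = 3] (mod 4) \<and> [q = 3] (mod 4) then -1 else 1)"
proof -
  have "odd p" "odd q" using assms prime_odd_int by auto
  define d e where "d = (p - 1) div 2" and "e = (q - 1) div 2"
  have d: "p = 2 * d + 1" "0 \<le> d" and e: "q = 2 * e + 1" "0 \<le> e"
    using \<open>odd p\<close> \<open>odd q\<close> assms unfolding d_def e_def by (auto elim!: oddE)
  have p3: "[p = 3] (mod 4) \<longleftrightarrow> odd d" and q3: "[q = 3] (mod 4) \<longleftrightarrow> odd e"
    unfolding d(1) e(1) by (rule cong_3_mod_4_iff)+
  have "Legendre p q * Legendre q p = (-1) ^ nat (d * e)"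
    using Quadratic_Reciprocity_int[of p q] assms by (simp add: d_def e_def)
  also have "\<dots> = (if odd d \<and> odd e then -1 else 1)"
    using d(2) e(2) by (simp add: minus_one_power_iff even_nat_iff)
  finally show ?thesis by (simp add: p3 q3)
qed

text \<open>First half of a double induction: one argument stays prime while the other is built up
  from its prime factors.\<close>

lemma jacobi_reciprocity_prime:
  assumes "odd n" "0 < n" "coprime p n" "prime p" "2 < p"
  shows "jacobi p n * Legendre n p = (if [p = 3] (mod 4) \<and> [n = 3] (mod 4) then -1 else 1)"
  using assms
proof (induction n rule: odd_pos_induct)
  case one
  then show ?case by (simp add: Legendre_one cong_def)
next
  case (factor q n)
  then have "coprime p n" "p \<noteq> q" by auto
  then have IH: "jacobi p n * Legendre n p = (if [p = 3] (mod 4) \<and> [n = 3] (mod 4) then -1 else 1)"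
    using factor by blast
  have "jacobi p (q * n) * Legendre (q * n) p
      = (Legendre p q * Legendre q p) * (jacobi p n * Legendre n p)"
    using factor by (simp add: jacobi_times_prime Legendre_mult)
  then show ?case unfolding IH
    using Legendre_reciprocity[of p q] factor \<open>p \<noteq> q\<close> by (auto simp: cong_3_mod_4_mult)
qed

lemma jacobi_reciprocity:
  assumes "odd m" "0 < m" "odd n" "0 < n" "coprime m n"
  shows "jacobi m n = (if [m = 3] (mod 4) \<and> [n = 3] (mod 4) then - jacobi n m else jacobi n m)"
proof -
  have "jacobi m n * jacobi n m = (if [m = 3] (mod 4) \<and> [n = 3] (mod 4) then -1 else 1)"
    using assms
  proof (induction m rule: odd_pos_induct)
    case one
    then show ?case by (simp add: jacobi_one_left cong_def)
  next
    case (factor p m)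
    then have "coprime m n" "coprime p n" by auto
    then have IH: "jacobi m n * jacobi n m = (if [m = 3] (mod 4) \<and> [n = 3] (mod 4) then -1 else 1)"
      using factor by blast
    have "jacobi (p * m) n * jacobi n (p * m)
        = (jacobi p n * Legendre n p) * (jacobi m n * jacobi n m)"
      using factor by (simp add: jacobi_times_prime jacobi_mult_left)
    then show ?case unfolding IH
      using jacobi_reciprocity_prime[of n p] factor \<open>coprime p n\<close> by (auto simp: cong_3_mod_4_mult)
  qed
  \<comment> \<open>A symbol equal to 1 or -1 is its own inverse, so the product formula can be
    solved for the other symbol.\<close>
  moreover have "jacobi n m = 1 \<or> jacobi n m = -1"
    using jacobi_coprime assms by (simp add: coprime_commute)
  ultimately show ?thesis by (auto split: if_splits)
qed

text \<open>Reciprocity between \<open>m\<close> and \<open>m + 2\<close>, using \<open>2 = - m\<close> modulo \<open>m + 2\<close> and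
  \<open>m + 2 = 2\<close> modulo \<open>m\<close>.\<close>
lemma jacobi_two_step:
  fixes m :: int
  assumes "odd m" "0 < m"
  shows "jacobi 2 (m + 2) = (if [m = 1] (mod 4) then -1 else 1) * jacobi 2 m"
proof -
  have n: "odd (m + 2)" "0 < m + 2" using assms by auto
  have cop: "coprime m (m + 2)"
  proof (rule coprimeI)
    fix c assume c: "c dvd m" "c dvd m + 2"
    then have "c dvd 2" using dvd_add_right_iff by blast
    moreover have "odd c" using c(1) assms(1) by (metis dvd_trans)
    ultimately show "is_unit c" by (meson coprime_absorb_left coprime_right_2_iff_odd)
  qed
  \<comment> \<open>Adding 2 swaps the classes 1 and 3 modulo 4, so \<open>m\<close> and
    \<open>m + 2\<close> are never both 3 and reciprocity between them carries no sign.\<close>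
  have "(m + 2) mod 4 = (m mod 4 + 2) mod 4" by (simp add: mod_add_left_eq)
  then have n3: "[m + 2 = 3] (mod 4) \<longleftrightarrow> [m = 1] (mod 4)"
    and excl: "\<not> ([m = 3] (mod 4) \<and> [m + 2 = 3] (mod 4))"
    using odd_mod_4[OF assms(1)] by (auto simp: cong_def)
  have "jacobi 2 (m + 2) = jacobi ((-1) * m) (m + 2)"
    by (rule jacobi_cong) (simp add: cong_iff_dvd_diff add.commute)
  also have "\<dots> = jacobi (-1) (m + 2) * jacobi m (m + 2)"
    by (rule jacobi_mult_left[OF n])
  also have "jacobi (-1) (m + 2) = (if [m = 1] (mod 4) then -1 else 1)"
    unfolding jacobi_minus_one[OF n] n3 ..
  also have "jacobi m (m + 2) = jacobi (m + 2) m"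
    unfolding jacobi_reciprocity[OF assms n cop] using excl by (rule if_not_P)
  also have "\<dots> = jacobi 2 m"
    by (rule jacobi_cong) (simp add: cong_iff_dvd_diff)
  finally show ?thesis .
qed

text \<open>Walking along the odd numbers from 1, the sign changes exactly when leaving a number
  that is 1 modulo 4. This produces the pattern 1, -1, -1, 1 with period 8.\<close>

lemma jacobi_two:
  assumes "odd n" "0 < n"
  shows "jacobi 2 n = (if [n = 1] (mod 8) \<or> [n = 7] (mod 8) then 1 else -1)"
proof -
  have "jacobi 2 (2 * int j + 1)
      = (if [2 * int j + 1 = 1] (mod 8) \<or> [2 * int j + 1 = 7] (mod 8) then 1 else -1)" for j
  proof (induction j)
    case 0
    show ?case by (simp add: cong_def)
  next
    case (Suc j)
    let ?m = "2 * int j + 1"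
    have "jacobi 2 (2 * int (Suc j) + 1) = jacobi 2 (?m + 2)"
      by (simp add: algebra_simps)
    also have "\<dots> = (if [?m = 1] (mod 4) then -1 else 1) * jacobi 2 ?m"
      by (rule jacobi_two_step) simp_all
    finally have 1: "jacobi 2 (2 * int (Suc j) + 1)
      = (if [?m = 1] (mod 4) then -1 else 1) * jacobi 2 ?m" .
    have "2 * int (Suc j) + 1 = ?m + 2" by simp
    then have "(2 * int (Suc j) + 1) mod 8 = (?m mod 8 + 2) mod 8"
      by (simp only: mod_add_left_eq)
    moreover have "?m mod 4 = ?m mod 8 mod 4" by (simp add: mod_mod_cancel)
    ultimately show ?case
      using 1 Suc.IH odd_mod_8[of ?m] by (auto simp: cong_def)
  qed
  from this[of "nat (n div 2)"] show ?thesis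
    using assms by (simp add: odd_two_times_div_two_succ)
qed

section \<open>Dedekind sums\<close>

lemma sum_id_int: "2 * (\<Sum>j\<in>{0..<n}. j) = n * (n - 1)" if "0 \<le> n" for n :: int
  using that
proof (induction n rule: int_ge_induct)
  case (step i)
  then have "{0..<i + 1} = insert i {0..<i}" by auto
  with step show ?case by (simp add: algebra_simps)
qed simp

lemma sum_squares_int: "6 * (\<Sum>j\<in>{0..<n}. j\<^sup>2) = n * (n - 1) * (2 * n - 1)" if "0 \<le> n" for n :: int
  using that
proof (induction n rule: int_ge_induct)
  case (step i)
  then have "{0..<i + 1} = insert i {0..<i}" by auto
  with step show ?case by (simp add: algebra_simps power2_eq_square)
qed simp

lemma bij_betw_mult_mod:
  assumes "coprime h k" "0 < (k::int)"
  shows "bij_betw (\<lambda>j. (h * j) mod k) {0..<k} {0..<k}"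
proof -
  have "inj_on (\<lambda>j. (h * j) mod k) {0..<k}"
  proof (rule inj_onI)
    fix x y assume "x \<in> {0..<k}" "y \<in> {0..<k}" "(h * x) mod k = (h * y) mod k"
    moreover from this have "[x = y] (mod k)"
      using assms(1) by (simp add: cong_mult_lcancel flip: cong_def)
    ultimately show "x = y" by (simp add: cong_def)
  qed
  moreover have "(\<lambda>j. (h * j) mod k) ` {0..<k} \<subseteq> {0..<k}" using assms(2) by auto
  ultimately show ?thesis
    by (simp add: bij_betw_def endo_inj_surj)
qed

lemma sum_mult_mod:
  assumes "coprime h k" "0 < (k::int)"
  shows "(\<Sum>j\<in>{0..<k}. g ((h * j) mod k)) = (\<Sum>j\<in>{0..<k}. g j)"
  by (rule sum.reindex_bij_betw[OF bij_betw_mult_mod[OF assms]])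

text \<open>For coprime \<open>h\<close> and \<open>k\<close> this is \<open>12 k s(h, k)\<close>, see \<open>dedekind_sum_eq\<close>.\<close>
definition dede :: "int \<Rightarrow> int \<Rightarrow> int" where
  "dede h k = 2 * h * (k - 1) * (2 * k - 1) - 3 * k * (k - 1)
     - 12 * (\<Sum>j\<in>{0..<k}. j * ((h * j) div k))"

lemma sum_id_mult_mod:
  assumes "0 < (k::int)"
  shows "12 * (\<Sum>j\<in>{0..<k}. j * ((h * j) mod k)) = k * dede h k + 3 * k\<^sup>2 * (k - 1)"
proof -
  define F S where "F = (\<Sum>j\<in>{0..<k}. j * ((h * j) div k))" and "S = (\<Sum>j\<in>{0..<k}. j\<^sup>2)"
  have "j * ((h * j) mod k) = h * j\<^sup>2 - k * (j * ((h * j) div k))" for j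
    by (simp add: minus_mult_div_eq_mod[symmetric] algebra_simps power2_eq_square)
  then have "(\<Sum>j\<in>{0..<k}. j * ((h * j) mod k)) = h * S - k * F"
    by (simp add: sum_subtractf sum_distrib_left F_def S_def)
  moreover have "6 * S = k * (k - 1) * (2 * k - 1)"
    unfolding S_def using sum_squares_int[of k] assms by simp
  moreover have "12 * (h * S - k * F) - (k * (2 * h * (k - 1) * (2 * k - 1) - 3 * k * (k - 1) - 12 * F)
      + 3 * k\<^sup>2 * (k - 1)) = 2 * h * (6 * S - k * (k - 1) * (2 * k - 1))"
    by (simp add: algebra_simps power2_eq_square)
  ultimately show ?thesis
    unfolding dede_def F_def[symmetric] by simp
qed

lemma sawtooth_div:
  assumes "0 < k"
  shows "sawtooth (of_int a / of_int k) =
    (if k dvd a then 0 else of_int (a mod k) / of_int k - 1 / 2)"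
proof -
  have "of_int a / of_int k \<in> (\<int> :: real set) \<longleftrightarrow> k dvd a"
    using assms by (simp add: of_int_div_of_int_in_Ints_iff)
  moreover have "of_int a / of_int k - of_int (a div k) = (of_int (a mod k) / of_int k :: real)"
    using assms by (simp add: real_of_int_div4 field_simps minus_mult_div_eq_mod[symmetric])
  ultimately show ?thesis
    by (simp add: sawtooth_def floor_divide_of_int_eq)
qed

text \<open>Expanding the product of sawtooth values leaves one mixed sum; the linear sums are known
  because multiplication by \<open>h\<close> permutes the residues.\<close>

lemma dedekind_sum_eq:
  assumes "coprime h k" "0 < k"
  shows "12 * of_int k * dedekind_sum h k = of_int (dede h k)"
proof -
  let ?K = "of_int k :: real"
  \<comment> \<open>At \<open>j = 0\<close> the expanded product would give 1/4 while the sawtooth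
    vanishes; the conditional last term corrects this.\<close>
  have summand: "sawtooth (of_int j / ?K) * sawtooth (of_int (h * j) / ?K) =
      of_int (j * ((h * j) mod k)) / ?K\<^sup>2 - of_int j / (2 * ?K)
        - of_int ((h * j) mod k) / (2 * ?K) + (if j = 0 then 0 else 1 / 4)"
    if "j \<in> {0..<k}" for j
  proof (cases "j = 0")
    case False
    then have "\<not> k dvd j" using that zdvd_not_zless by auto
    moreover from this have "\<not> k dvd h * j"
      using assms(1) by (simp add: coprime_commute coprime_dvd_mult_right_iff)
    moreover have "j mod k = j" using that by simp
    ultimately show ?thesis
      using assms(2) False by (simp add: sawtooth_div field_simps power2_eq_square del: of_int_mult)
        (simp add: algebra_simps)
  qed (simp add: sawtooth_def)
  have one: "(\<Sum>j\<in>{0..<k}. if j = 0 then 0 else 1 / 4 :: real) = (?K - 1) / 4"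
  proof -
    have "{0..<k} = insert 0 {1..<k}" using assms(2) by auto
    moreover have "(\<Sum>j\<in>{1..<k}. if j = 0 then 0 else 1 / 4 :: real) = (\<Sum>j\<in>{1..<k}. 1 / 4)"
      by (rule sum.cong) auto
    ultimately show ?thesis using assms(2) by simp
  qed
  have S1: "(\<Sum>j\<in>{0..<k}. of_int j) = ?K * (?K - 1) / 2"
    using arg_cong[OF sum_id_int[of k], of real_of_int] assms(2) by simp
  have S1': "(\<Sum>j\<in>{0..<k}. of_int ((h * j) mod k)) = ?K * (?K - 1) / 2"
    using sum_mult_mod[OF assms, of real_of_int] S1 by simp
  have S2: "(\<Sum>j\<in>{0..<k}. of_int (j * ((h * j) mod k)))
      = (?K * of_int (dede h k) + 3 * ?K\<^sup>2 * (?K - 1)) / 12"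
    using arg_cong[OF sum_id_mult_mod[OF assms(2), of h], of real_of_int] by simp
  have "dedekind_sum h k = (\<Sum>j\<in>{0..<k}. of_int (j * ((h * j) mod k)) / ?K\<^sup>2
      - of_int j / (2 * ?K) - of_int ((h * j) mod k) / (2 * ?K) + (if j = 0 then 0 else 1 / 4))"
    unfolding dedekind_sum_def by (rule sum.cong[OF refl summand])
  also have "\<dots> = (\<Sum>j\<in>{0..<k}. of_int (j * ((h * j) mod k))) / ?K\<^sup>2
      - (\<Sum>j\<in>{0..<k}. of_int j) / (2 * ?K)
      - (\<Sum>j\<in>{0..<k}. of_int ((h * j) mod k)) / (2 * ?K) + (?K - 1) / 4"
    unfolding one[symmetric]
    by (simp add: sum.distrib sum_subtractf sum_divide_distrib del: of_int_mult)
  finally have "dedekind_sum h k = (?K * of_int (dede h k) + 3 * ?K\<^sup>2 * (?K - 1)) / 12 / ?K\<^sup>2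
      - ?K * (?K - 1) / 2 / (2 * ?K) - ?K * (?K - 1) / 2 / (2 * ?K) + (?K - 1) / 4"
    unfolding S1 S1' S2 .
  then show ?thesis
    using assms(2) by (simp add: field_simps power2_eq_square)
qed

text \<open>Each floor grows by \<open>j\<close>, which subtracts 12 times the sum of squares; the
  leading term of \<open>dede\<close> grows by the same amount.\<close>

lemma dede_add: "0 < k \<Longrightarrow> dede (h + k) k = dede h k"
proof -
  assume k: "0 < k"
  define F S where "F = (\<Sum>j\<in>{0..<k}. j * ((h * j) div k))" and "S = (\<Sum>j\<in>{0..<k}. j\<^sup>2)"
  from k have "((h + k) * j) div k = (h * j) div k + j" for j
    by (simp add: distrib_right)
  then have *: "(\<Sum>j\<in>{0..<k}. j * (((h + k) * j) div k)) = F + S"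
    by (simp add: distrib_left sum.distrib power2_eq_square F_def S_def)
  have "6 * S = k * (k - 1) * (2 * k - 1)"
    unfolding S_def using sum_squares_int[of k] k by simp
  moreover have "2 * (h + k) * (k - 1) * (2 * k - 1) - 3 * k * (k - 1) - 12 * (F + S)
      - (2 * h * (k - 1) * (2 * k - 1) - 3 * k * (k - 1) - 12 * F)
      = 2 * (k * (k - 1) * (2 * k - 1) - 6 * S)"
    by (simp add: algebra_simps)
  ultimately show ?thesis
    unfolding dede_def * F_def[symmetric] by simp
qed

lemma dede_cong:
  assumes "[h = h'] (mod k)" "0 < k"
  shows "dede h k = dede h' k"
proof -
  have add: "dede (h + int n * k) k = dede h k" for h n
    by (induction n) (simp_all add: dede_add[OF assms(2)] distrib_right add.assoc[symmetric] add.commute[of k])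
  obtain t where t: "h = h' + k * t" using assms(1) by (metis cong_iff_lin cong_sym)
  show ?thesis
  proof (cases "0 \<le> t")
    case True
    then show ?thesis using add[of h' "nat t"] t by (simp add: mult.commute)
  next
    case False
    then show ?thesis using add[of h "nat (- t)"] t by (simp add: mult.commute)
  qed
qed

text \<open>Away from integers the floor of \<open>-x\<close> is \<open>-1\<close> minus the floor
  of \<open>x\<close>. The extra -1 contributes the sum of all \<open>j\<close>, which balances the
  term of \<open>dede\<close> free of \<open>h\<close>.\<close>

lemma dede_minus:
  assumes "coprime h k" "0 < k"
  shows "dede (- h) k = - dede h k"
proof -
  define F T where "F = (\<Sum>j\<in>{0..<k}. j * ((h * j) div k))" and "T = (\<Sum>j\<in>{0..<k}. j)"
  have "j * ((- h * j) div k) = - (j * ((h * j) div k)) - j" if "j \<in> {0..<k}" for j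
  proof (cases "j = 0")
    case False
    then have "\<not> k dvd j" using that zdvd_not_zless by auto
    then have "\<not> k dvd h * j"
      using assms(1) by (simp add: coprime_commute coprime_dvd_mult_right_iff)
    then have eq: "(- h * j) div k = - ((h * j) div k) - 1"
      using assms(2) by (simp add: zdiv_zminus1_eq_if dvd_eq_mod_eq_0)
    show ?thesis unfolding eq by (simp add: algebra_simps)
  qed simp
  then have *: "(\<Sum>j\<in>{0..<k}. j * ((- h * j) div k)) = - F - T"
    by (simp add: sum_subtractf sum_negf F_def T_def)
  have "2 * T = k * (k - 1)"
    unfolding T_def using sum_id_int[of k] assms(2) by simp
  moreover have "2 * - h * (k - 1) * (2 * k - 1) - 3 * k * (k - 1) - 12 * (- F - T)
      - (- (2 * h * (k - 1) * (2 * k - 1) - 3 * k * (k - 1) - 12 * F)) = 6 * (2 * T - k * (k - 1))"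
    by (simp add: algebra_simps)
  ultimately show ?thesis
    unfolding dede_def * F_def[symmetric] by simp
qed

text \<open>Comparing \<open>\<Sum> (h j mod k)\<^sup>2\<close> with \<open>\<Sum> j\<^sup>2\<close> evaluates the linear sum
  \<open>\<Sum> j \<lfloor>h j / k\<rfloor>\<close> in terms of \<open>\<Sum> \<lfloor>h j / k\<rfloor>\<^sup>2\<close>.\<close>
lemma dede_mult_eq:
  assumes "coprime h k" "0 < k"
  shows "h * dede h k = (h\<^sup>2 + 1) * (k - 1) * (2 * k - 1) - 3 * h * k * (k - 1)
    - 6 * k * (\<Sum>j\<in>{0..<k}. ((h * j) div k)\<^sup>2)"
proof -
  define F Q S where "F = (\<Sum>j\<in>{0..<k}. j * ((h * j) div k))"
    and "Q = (\<Sum>j\<in>{0..<k}. ((h * j) div k)\<^sup>2)" and "S = (\<Sum>j\<in>{0..<k}. j\<^sup>2)"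
  have "((h * j) mod k)\<^sup>2 = h\<^sup>2 * j\<^sup>2 - 2 * h * k * (j * ((h * j) div k)) + k\<^sup>2 * ((h * j) div k)\<^sup>2" for j
    by (simp add: minus_mult_div_eq_mod[symmetric] algebra_simps power2_eq_square)
  then have "(\<Sum>j\<in>{0..<k}. ((h * j) mod k)\<^sup>2) = h\<^sup>2 * S - 2 * h * k * F + k\<^sup>2 * Q"
    by (simp add: sum_subtractf sum.distrib sum_distrib_left F_def Q_def S_def)
  then have "S = h\<^sup>2 * S - 2 * h * k * F + k\<^sup>2 * Q"
    using sum_mult_mod[OF assms, of power2] by (simp add: S_def)
  moreover have "6 * S = k * (k - 1) * (2 * k - 1)"
    unfolding S_def using sum_squares_int[of k] assms(2) by simp
  \<comment> \<open>Both brackets on the right are relations already known to vanish; the positive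
    factor \<open>k\<close> is cancelled afterwards.\<close>
  moreover have "k * (12 * h * F) - k * ((h\<^sup>2 - 1) * (k - 1) * (2 * k - 1) + 6 * k * Q)
      = (h\<^sup>2 - 1) * (6 * S - k * (k - 1) * (2 * k - 1))
        + 6 * (S - (h\<^sup>2 * S - 2 * h * k * F + k\<^sup>2 * Q))"
    by (simp add: algebra_simps power2_eq_square)
  ultimately have "k * (12 * h * F) = k * ((h\<^sup>2 - 1) * (k - 1) * (2 * k - 1) + 6 * k * Q)"
    by simp
  then have "12 * h * F = (h\<^sup>2 - 1) * (k - 1) * (2 * k - 1) + 6 * k * Q"
    using assms(2) by simp
  moreover have "h * (2 * h * (k - 1) * (2 * k - 1) - 3 * k * (k - 1) - 12 * F)
      - ((h\<^sup>2 + 1) * (k - 1) * (2 * k - 1) - 3 * h * k * (k - 1) - 6 * k * Q)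
      = (h\<^sup>2 - 1) * (k - 1) * (2 * k - 1) + 6 * k * Q - 12 * h * F"
    by (simp add: algebra_simps power2_eq_square)
  ultimately show ?thesis unfolding dede_def F_def[symmetric] Q_def[symmetric] by simp
qed

text \<open>Reducing \<open>dede_mult_eq\<close> modulo \<open>k\<close> is immediate. The extra
  factor \<open>gcd 3 k\<close> comes from the cofactor of \<open>k\<close>: it divides both 3 and
  \<open>2 * k - 3\<close>.\<close>

lemma dede_mult_cong:
  assumes "coprime h k" "0 < k"
  shows "[h * dede h k = h\<^sup>2 + 1] (mod gcd 3 k * k)"
proof -
  let ?Q = "\<Sum>j\<in>{0..<k}. ((h * j) div k)\<^sup>2"
  have eq: "h * dede h k - (h\<^sup>2 + 1) = k * ((h\<^sup>2 + 1) * (2 * k - 3) + 3 * (- h * (k - 1) - 2 * ?Q))"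
    unfolding dede_mult_eq[OF assms] by (simp add: algebra_simps power2_eq_square)
  have "gcd 3 k dvd (h\<^sup>2 + 1) * (2 * k - 3) + 3 * (- h * (k - 1) - 2 * ?Q)"
    by (intro dvd_add dvd_diff dvd_mult dvd_mult2) auto
  then show ?thesis
    unfolding cong_iff_dvd_diff eq by (simp add: mult.commute mult_dvd_mono)
qed

text \<open>If \<open>k\<close> is 1 modulo 3 then 3 divides \<open>k - 1\<close>, and if
  \<open>k\<close> is 2 then it divides \<open>2 * k - 1\<close>. This supplies the modulus 3 that
  \<open>dede_mult_cong\<close> does not reach in this case.\<close>

lemma three_dvd_dede:
  assumes "\<not> 3 dvd k"
  shows "3 dvd dede h k"
proof -
  have "3 dvd (k - 1) * (2 * k - 1)"
  proof (cases "3 dvd k - 1")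
    case False
    with assms have "3 dvd 2 * k - 1" by presburger
    then show ?thesis by simp
  qed simp
  then have "3 dvd (2 * h) * ((k - 1) * (2 * k - 1))
      - 3 * (k * (k - 1) + 4 * (\<Sum>j\<in>{0..<k}. j * ((h * j) div k)))"
    by (intro dvd_diff[OF dvd_mult dvd_triv_left])
  then show ?thesis unfolding dede_def by (simp add: algebra_simps)
qed

text \<open>The residues of \<open>h * j\<close> permute those of \<open>j\<close>; equating the two
  sums and solving for the floors gives the value.\<close>

lemma sum_div_mult:
  assumes "coprime h k" "0 < (k::int)"
  shows "2 * (\<Sum>j\<in>{0..<k}. (h * j) div k) = (h - 1) * (k - 1)"
proof -
  define L T where "L = (\<Sum>j\<in>{0..<k}. (h * j) div k)" and "T = (\<Sum>j\<in>{0..<k}. j)"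
  have "(h * j) mod k = h * j - k * ((h * j) div k)" for j
    by (simp add: minus_mult_div_eq_mod)
  then have "(\<Sum>j\<in>{0..<k}. (h * j) mod k) = h * T - k * L"
    by (simp add: sum_subtractf sum_distrib_left L_def T_def)
  then have "T = h * T - k * L"
    using sum_mult_mod[OF assms, of "\<lambda>x. x"] by (simp add: T_def)
  moreover have "2 * T = k * (k - 1)"
    unfolding T_def using sum_id_int[of k] assms(2) by simp
  moreover have "k * (2 * L) - k * ((h - 1) * (k - 1))
      = 2 * (T - (h * T - k * L)) + (h - 1) * (2 * T - k * (k - 1))"
    by (simp add: algebra_simps)
  ultimately have "k * (2 * L) = k * ((h - 1) * (k - 1))"
    by simp
  then show ?thesis using assms(2) by (simp add: L_def)
qed

lemma sum_odds_int: "0 \<le> n \<Longrightarrow> (\<Sum>i\<in>{1..n}. 2 * i - 1) = (n::int)\<^sup>2"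
proof (induction n rule: int_ge_induct)
  case (step i)
  then have "{1..i + 1} = insert (i + 1) {1..i}" by auto
  with step show ?case by (simp add: algebra_simps power2_eq_square)
qed simp

lemma le_div_iff_mult_le_int: "0 < k \<Longrightarrow> i \<le> a div k \<longleftrightarrow> k * i \<le> a" for i a k :: int
proof
  assume k: "0 < k" and "i \<le> a div k"
  then have "k * i \<le> k * (a div k)" by simp
  also have "\<dots> \<le> a" using k pos_mod_sign[of k a] by (simp add: minus_mod_eq_mult_div[symmetric])
  finally show "k * i \<le> a" .
next
  assume k: "0 < k" and "k * i \<le> a"
  then have "k * i div k \<le> a div k" by (intro zdiv_mono1)
  with k show "i \<le> a div k" by simp
qed

text \<open>Both sides count lattice points below the diagonal, with weight \<open>2 i - 1\<close> in row \<open>i\<close>.\<close>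
lemma sum_div_squares:
  assumes "coprime h k" "0 < h" "0 < (k::int)"
  shows "(\<Sum>j\<in>{0..<k}. ((h * j) div k)\<^sup>2)
    = (\<Sum>i\<in>{1..<h}. (2 * i - 1) * (k - 1 - (k * i) div h))"
proof -
  have "((h * j) div k)\<^sup>2 = (\<Sum>i\<in>{1..<h}. if k * i \<le> h * j then 2 * i - 1 else 0)"
    if "j \<in> {0..<k}" for j
  proof -
    have "0 \<le> (h * j) div k" using that assms by (simp add: pos_imp_zdiv_nonneg_iff)
    moreover have "(h * j) div k < h"
    proof -
      have "h * j < k * h" using that assms(2) by simp
      then show ?thesis
        using le_div_iff_mult_le_int[OF assms(3), of h "h * j"] by linarith
    qed
    ultimately have "{1..(h * j) div k} = {i \<in> {1..<h}. k * i \<le> h * j}"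
      unfolding set_eq_iff mem_Collect_eq atLeastAtMost_iff atLeastLessThan_iff
        le_div_iff_mult_le_int[OF assms(3), symmetric]
      by (meson order_le_less_trans)
    \<comment> \<open>A square \<open>q\<^sup>2\<close> is the sum of the first \<open>q\<close> odd
      numbers, so column \<open>j\<close> spreads over the rows \<open>i\<close> below the
      diagonal.\<close>
    then have "((h * j) div k)\<^sup>2 = (\<Sum>i\<in>{i \<in> {1..<h}. k * i \<le> h * j}. 2 * i - 1)"
      using sum_odds_int[OF \<open>0 \<le> (h * j) div k\<close>] by metis
    also have "\<dots> = (\<Sum>i\<in>{1..<h}. if k * i \<le> h * j then 2 * i - 1 else 0)"
      by (rule sum.inter_filter) simp
    finally show ?thesis .
  qed
  then have "(\<Sum>j\<in>{0..<k}. ((h * j) div k)\<^sup>2)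
      = (\<Sum>i\<in>{1..<h}. \<Sum>j\<in>{0..<k}. if k * i \<le> h * j then 2 * i - 1 else 0)"
    by (subst sum.swap) simp
  also have "\<dots> = (\<Sum>i\<in>{1..<h}. (2 * i - 1) * (k - 1 - (k * i) div h))"
  proof (rule sum.cong[OF refl])
    fix i assume i: "i \<in> {1..<h}"
    \<comment> \<open>No lattice point with \<open>0 < i < h\<close> lies on the diagonal, so the
      weak inequality is strict and row \<open>i\<close> starts one past the floor.\<close>
    have "\<not> h dvd i" using i zdvd_not_zless by auto
    then have ndvd: "\<not> h dvd k * i"
      using assms(1) by (simp add: coprime_dvd_mult_right_iff)
    have "k * i \<le> h * j \<longleftrightarrow> (k * i) div h < j" for j
    proof -
      have "k * i \<noteq> h * j" using ndvd by auto
      then show ?thesis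
        using le_div_iff_mult_le_int[OF assms(2), of j "k * i"] by linarith
    qed
    moreover have "0 \<le> (k * i) div h" using i assms by (simp add: pos_imp_zdiv_nonneg_iff)
    ultimately have "{j \<in> {0..<k}. k * i \<le> h * j} = {(k * i) div h + 1..<k}"
      unfolding set_eq_iff mem_Collect_eq atLeastLessThan_iff by (meson add1_zle_eq le_less_trans less_imp_le)
    moreover have "(k * i) div h < k"
    proof -
      have "k * i < k * h" using i assms(3) by simp
      then show ?thesis
        using le_div_iff_mult_le_int[OF assms(2), of k "k * i"] by (simp add: mult.commute)
    qed
    ultimately have "(\<Sum>j\<in>{j \<in> {0..<k}. k * i \<le> h * j}. 2 * i - 1)
        = (2 * i - 1) * (k - 1 - (k * i) div h)"
      by (simp add: algebra_simps)
    then show "(\<Sum>j\<in>{0..<k}. if k * i \<le> h * j then 2 * i - 1 else 0)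
        = (2 * i - 1) * (k - 1 - (k * i) div h)"
      by (simp only: sum.inter_filter[OF finite_atLeastLessThan_int])
  qed
  finally show ?thesis .
qed

text \<open>This is Dedekind reciprocity with denominators cleared. \<open>dede h k\<close> is
  expressed by a sum of squared floors, and counting its lattice points by rows brings in the floor
  sum of \<open>dede k h\<close>.\<close>

lemma dede_reciprocity:
  assumes "coprime h k" "0 < h" "0 < k"
  shows "h * dede h k + k * dede k h = h\<^sup>2 + k\<^sup>2 + 1 - 3 * h * k"
proof -
  define G L T Q where "G = (\<Sum>i\<in>{0..<h}. i * ((k * i) div h))"
    and "L = (\<Sum>i\<in>{0..<h}. (k * i) div h)" and "T = (\<Sum>i\<in>{0..<h}. i)"
    and "Q = (\<Sum>j\<in>{0..<k}. ((h * j) div k)\<^sup>2)"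
  have ins: "{0..<h} = insert 0 {1..<h}" using assms(2) by auto
  have "Q = (\<Sum>i\<in>{1..<h}. (2 * i - 1) * (k - 1 - (k * i) div h))"
    unfolding Q_def by (rule sum_div_squares[OF assms])
  \<comment> \<open>The added row \<open>i = 0\<close> has weight -1 and contributes
    \<open>-(k - 1)\<close>, which the last term restores.\<close>
  also have "\<dots> = (\<Sum>i\<in>{0..<h}. (2 * i - 1) * (k - 1 - (k * i) div h)) + (k - 1)"
    unfolding ins by simp
  also have "(\<Sum>i\<in>{0..<h}. (2 * i - 1) * (k - 1 - (k * i) div h))
      = (\<Sum>i\<in>{0..<h}. 2 * (k - 1) * i - (k - 1) - 2 * (i * ((k * i) div h)) + (k * i) div h)"
    by (rule sum.cong) (simp_all add: algebra_simps)
  also have "\<dots> = 2 * (k - 1) * T - (k - 1) * h - 2 * G + L"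
    using assms(2) by (simp add: sum.distrib sum_subtractf sum_distrib_left G_def L_def T_def)
  finally have "Q = 2 * (k - 1) * T - (k - 1) * h - 2 * G + L + (k - 1)" .
  moreover have "2 * T = h * (h - 1)"
    unfolding T_def using sum_id_int[of h] assms(2) by simp
  moreover have "2 * L = (k - 1) * (h - 1)"
    unfolding L_def using sum_div_mult[of k h] assms by (simp add: coprime_commute)
  moreover have "h * dede h k = (h\<^sup>2 + 1) * (k - 1) * (2 * k - 1) - 3 * h * k * (k - 1) - 6 * k * Q"
    unfolding Q_def by (rule dede_mult_eq[OF assms(1,3)])
  moreover have "dede k h = 2 * k * (h - 1) * (2 * h - 1) - 3 * h * (h - 1) - 12 * G"
    unfolding G_def dede_def ..
  \<comment> \<open>The right side is a combination of the relations just collected, so each of its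
    brackets is zero.\<close>
  moreover have "h * dede h k + k * dede k h - (h\<^sup>2 + k\<^sup>2 + 1 - 3 * h * k) =
      (h * dede h k - ((h\<^sup>2 + 1) * (k - 1) * (2 * k - 1) - 3 * h * k * (k - 1) - 6 * k * Q))
      + k * (dede k h - (2 * k * (h - 1) * (2 * h - 1) - 3 * h * (h - 1) - 12 * G))
      - 6 * k * (Q - (2 * (k - 1) * T - (k - 1) * h - 2 * G + L + (k - 1)))
      - 6 * k * (k - 1) * (2 * T - h * (h - 1)) - 3 * k * (2 * L - (k - 1) * (h - 1))"
    by (simp add: algebra_simps power2_eq_square)
  ultimately show ?thesis by simp
qed

section \<open>Dedekind sums modulo powers of two\<close>

text \<open>One Euclidean exchange: Dedekind reciprocity passes from \<open>dede k h\<close> to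
  \<open>dede h k\<close>, and Jacobi reciprocity accounts for the matching change of
  symbol.\<close>

lemma dede_mod_8_aux:
  assumes "odd h" "0 < h" "odd k" "0 < k" "coprime h k"
    and IH: "[dede k h = h + 1 - 2 * jacobi k h] (mod 8)"
  shows "[dede h k = k + 1 - 2 * jacobi h k] (mod 8)"
proof -
  obtain p where p: "h = 2 * p + 1" using assms(1) by (rule oddE)
  obtain q where q: "k = 2 * q + 1" using assms(3) by (rule oddE)
  define j where "j = jacobi h k"
  define j' where "j' = jacobi k h"
  have "odd j" using jacobi_coprime[of k h] assms by (auto simp: j_def)
  obtain y where y: "dede k h = h + 1 - 2 * j' + 8 * y"
    using IH unfolding j'_def by (metis cong_iff_lin cong_sym)
  have h3: "[h = 3] (mod 4) \<longleftrightarrow> odd p" and k3: "[k = 3] (mod 4) \<longleftrightarrow> odd q"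
    unfolding p q by (rule cong_3_mod_4_iff)+
  have "h * (dede h k - (k + 1 - 2 * j)) =
      h\<^sup>2 + k\<^sup>2 + 1 - 3 * h * k - k * (h + 1 - 2 * j' + 8 * y) - h * (k + 1 - 2 * j)"
    using dede_reciprocity[OF assms(5,2,4)] unfolding y by (simp add: algebra_simps)
  also have "\<dots> = 4 * (p\<^sup>2 + q\<^sup>2 - 2 * p - 2 * q - 5 * p * q - 1) + 2 * (j' * k + j * h) - 8 * (k * y)"
    unfolding p q by (simp add: algebra_simps power2_eq_square)
  also have "8 dvd \<dots>"
  proof -
    have "2 dvd (p\<^sup>2 + q\<^sup>2 - 2 * p - 2 * q - 5 * p * q - 1) + z \<Longrightarrow>
      8 dvd 4 * (p\<^sup>2 + q\<^sup>2 - 2 * p - 2 * q - 5 * p * q - 1) + 4 * z - 8 * (k * y)" for z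
      by presburger
    \<comment> \<open>Reciprocity gives \<open>j = j'\<close> or \<open>j = - j'\<close>; either way
      the term is 4 times an explicit \<open>z\<close>, and divisibility by 8 becomes a parity
      check.\<close>
    moreover have "\<exists>z. 2 * (j' * k + j * h) = 4 * z \<and>
      even ((p\<^sup>2 + q\<^sup>2 - 2 * p - 2 * q - 5 * p * q - 1) + z)"
    proof (cases "odd p \<and> odd q")
      case True
      then have "j = - j'"
        using jacobi_reciprocity[OF assms(1-5)] h3 k3 by (simp add: j_def j'_def)
      then have "2 * (j' * k + j * h) = 4 * (j' * (q - p))" unfolding p q by (simp add: algebra_simps)
      moreover have "even ((p\<^sup>2 + q\<^sup>2 - 2 * p - 2 * q - 5 * p * q - 1) + j' * (q - p))"
        using True by simp
      ultimately show ?thesis by blast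
    next
      case False
      then have "j = j'"
        using jacobi_reciprocity[OF assms(1-5)] h3 k3 by (auto simp: j_def j'_def)
      then have "2 * (j' * k + j * h) = 4 * (j' * (p + q + 1))" unfolding p q by (simp add: algebra_simps)
      moreover have "even ((p\<^sup>2 + q\<^sup>2 - 2 * p - 2 * q - 5 * p * q - 1) + j' * (p + q + 1))"
        using False \<open>odd j\<close> \<open>j = j'\<close> by auto
      ultimately show ?thesis by blast
    qed
    ultimately show ?thesis by metis
  qed
  finally have "8 dvd h * (dede h k - (k + 1 - 2 * j))" .
  moreover have "coprime 8 h"
    using assms(1) coprime_power_left_iff[of 2 3 h] by (simp add: coprime_left_2_iff_odd)
  ultimately show ?thesis
    by (simp add: coprime_dvd_mult_right_iff cong_iff_dvd_diff j_def)
qed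

text \<open>Euclidean descent on the modulus: reduce \<open>h\<close> modulo \<open>k\<close>,
  exchange the arguments, and use the claim for the smaller modulus.\<close>

lemma dede_mod_8:
  assumes "odd k" "0 < k" "coprime h k"
  shows "[dede h k = k + 1 - 2 * jacobi h k] (mod 8)"
  using assms
proof (induction "nat k" arbitrary: h k rule: less_induct)
  case less
  show ?case
  proof (cases "k = 1")
    case True
    moreover have "{0..<1 :: int} = {0}" by auto
    ultimately show ?thesis by (simp add: dede_def)
  next
    case False
    then have "1 < k" using less.prems by simp
    have small: "[dede r k = k + 1 - 2 * jacobi r k] (mod 8)"
      if "odd r" "0 < r" "r < k" "coprime r k" for r
      by (rule dede_mod_8_aux) (use that less.prems less.hyps[of r k] in \<open>auto simp: coprime_commute\<close>)
    define r where "r = h mod k"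
    have r: "0 < r" "r < k" "coprime r k" "[h = r] (mod k)"
    proof -
      show "coprime r k" using less.prems by (simp add: r_def)
      moreover have "0 \<le> r" "r < k" using \<open>1 < k\<close> by (simp_all add: r_def)
      ultimately show "0 < r" "r < k" using \<open>1 < k\<close> by (auto simp: le_less)
      show "[h = r] (mod k)" by (simp add: r_def cong_def)
    qed
    have "[dede r k = k + 1 - 2 * jacobi r k] (mod 8)"
    proof (cases "odd r")
      case True
      then show ?thesis using small r by blast
    next
      case False
      \<comment> \<open>The exchange needs an odd remainder. As \<open>k\<close> is odd, an even
        \<open>r\<close> has the odd complement \<open>s\<close>, and \<open>r\<close> is congruent
        to \<open>- s\<close>.\<close>
      define s where "s = k - r"
      have "coprime (r - k) k"
        using r(3) coprime_iff_gcd_eq_1 gcd_diff1 by metis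
      then have s: "odd s" "0 < s" "s < k" "coprime s k"
        using r less.prems False coprime_minus_left_iff[of "r - k" k] by (simp_all add: s_def)
      have cong: "[r = - s] (mod k)" by (simp add: s_def cong_iff_dvd_diff)
      have "dede r k = - dede s k"
        using dede_cong[OF cong] dede_minus[OF s(4)] less.prems by simp
      moreover have "jacobi r k = jacobi (-1) k * jacobi s k"
        using jacobi_cong[OF cong] jacobi_mult_left[of k "-1" s] less.prems by simp
      moreover have "[- dede s k = - (k + 1 - 2 * jacobi s k)] (mod 8)"
        using small[OF s] by (simp only: cong_minus_minus_iff)
      \<comment> \<open>The difference of the sides is \<open>2 * (k + 1)\<close> minus 4 or -4 when
        \<open>k\<close> is 1 modulo 4, and \<open>2 * (k + 1)\<close> when it is 3; both are
        multiples of 8.\<close>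
      moreover have "[- (k + 1 - 2 * jacobi s k) = k + 1 - 2 * (jacobi (-1) k * jacobi s k)] (mod 8)"
      proof -
        obtain q where q: "k = 2 * q + 1" using less.prems(1) by (rule oddE)
        have js: "jacobi s k = 1 \<or> jacobi s k = -1"
          using jacobi_coprime less.prems s by blast
        have "[k = 3] (mod 4) \<longleftrightarrow> odd q"
          unfolding q by (rule cong_3_mod_4_iff)
        then have "jacobi (-1) k = (if odd q then -1 else 1)"
          using jacobi_minus_one less.prems by simp
        then show ?thesis
          using js unfolding q cong_iff_dvd_diff by (auto elim!: evenE oddE simp: algebra_simps)
      qed
      ultimately show ?thesis by (metis cong_trans)
    qed
    then show ?thesis using dede_cong[OF r(4)] jacobi_cong[OF r(4)] less.prems by simp
  qed
qed

text \<open>Since \<open>h\<close> is odd, \<open>dede k h\<close> is known modulo 8; its factor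
  \<open>k\<close> in the reciprocity law raises the modulus to \<open>8 * k\<close>.\<close>

lemma dede_mod_even:
  assumes "odd h" "0 < h" "0 < k" "coprime h k"
  shows "[h * dede h k = h\<^sup>2 + k\<^sup>2 + 3 * k + 1 + 2 * k * jacobi k h] (mod 8 * k)"
proof -
  have "[dede k h = h + 1 - 2 * jacobi k h] (mod 8)"
    using dede_mod_8 assms by (simp add: coprime_commute)
  then obtain y where y: "dede k h = h + 1 - 2 * jacobi k h + 8 * y"
    by (metis cong_iff_lin cong_sym)
  obtain p where p: "h = 2 * p + 1" using assms(1) by (rule oddE)
  have "h * dede h k - (h\<^sup>2 + k\<^sup>2 + 3 * k + 1 + 2 * k * jacobi k h)
      = - 3 * h * k - 3 * k - 2 * k * jacobi k h - k * (h + 1 - 2 * jacobi k h + 8 * y)"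
    using dede_reciprocity[OF assms(4,2,3)] unfolding y by simp
  also have "\<dots> = 8 * k * (- p - 1 - y)"
    unfolding p by (simp add: algebra_simps)
  finally show ?thesis by (simp add: cong_iff_dvd_diff)
qed

lemma jacobi_power_left:
  assumes "odd n" "0 < n"
  shows "jacobi (a ^ l) n = jacobi a n ^ l"
  by (induction l) (simp_all add: jacobi_one_left jacobi_mult_left assms)

text \<open>Moves \<open>h\<close> from the bottom of the symbol to the top. Modulo 4 the factor
  \<open>h\<close> absorbs the reciprocity sign for \<open>k'\<close> equal to 3 and creates one for
  \<open>k'\<close> equal to 1; the factor 2 adds the condition modulo 8. These are the two sign
  patterns of \<open>psi\<close>.\<close>

lemma jacobi_flip_mod_4:
  assumes "odd h" "0 < h" "odd k'" "0 < k'" "coprime h k'"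
  shows "[h * jacobi (2 ^ l * k') h = jacobi h k' *
    ((if [k' = 1] (mod 4) \<and> \<not> [h = 1] (mod 4) then -1 else 1) *
     (if odd l \<and> \<not> ([h = 1] (mod 8) \<or> [h = 7] (mod 8)) then -1 else 1))] (mod 4)"
proof -
  define e where "e = (if odd l \<and> \<not> ([h = 1] (mod 8) \<or> [h = 7] (mod 8)) then -1 else (1::int))"
  define x where "x = jacobi h k' * e"
  have "jacobi 2 h ^ l = e"
    using jacobi_two[OF assms(1,2)] by (auto simp: e_def minus_one_power_iff)
  then have eq: "jacobi (2 ^ l * k') h = e * jacobi k' h"
    using assms by (simp add: jacobi_mult_left jacobi_power_left)
  have rec: "jacobi k' h = (if [h = 3] (mod 4) \<and> [k' = 3] (mod 4) then - jacobi h k' else jacobi h k')"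
    using jacobi_reciprocity[of k' h] assms by (simp add: coprime_commute conj_commute)
  have h4: "h mod 4 = 1 \<or> h mod 4 = 3" and k4: "k' mod 4 = 1 \<or> k' mod 4 = 3"
    using odd_mod_4 assms by blast+
  have m1: "[h * x = x] (mod 4)" if "h mod 4 = 1"
    using cong_mult[of h 1 4 x x] that by (simp add: cong_def)
  have m3: "[h * x = - x] (mod 4)" if "h mod 4 = 3"
  proof -
    have "[h = -1] (mod 4)" using that by (simp add: cong_def)
    then show ?thesis using cong_mult[of h "-1" 4 x x] by simp
  qed
  have m3': "[h * (- x) = x] (mod 4)" if "h mod 4 = 3"
    using cong_minus_minus_iff[of "h * x" "- x" 4] m3[OF that] by simp
  have lhs: "h * jacobi (2 ^ l * k') h = (if [h = 3] (mod 4) \<and> [k' = 3] (mod 4) then h * (- x) else h * x)"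
    unfolding eq rec x_def by simp
  have rhs: "jacobi h k' * ((if [k' = 1] (mod 4) \<and> \<not> [h = 1] (mod 4) then -1 else 1) * e)
      = (if [k' = 1] (mod 4) \<and> \<not> [h = 1] (mod 4) then - x else x)"
    by (simp add: x_def)
  show ?thesis
    unfolding e_def[symmetric] lhs rhs using h4 k4 m1 m3 m3' by (auto simp: cong_def[of h] cong_def[of k'])
qed

section \<open>The contribution of a single index\<close>

lemma cong_cmult_modulus: "[a = b] (mod n) \<Longrightarrow> [c * a = c * b] (mod c * n)" for a b c n :: int
  unfolding cong_iff_dvd_diff right_diff_distrib[symmetric] by (rule mult_dvd_mono[OF dvd_refl])

text \<open>If 3 divides \<open>k\<close>, the modulus of \<open>dede_mult_cong\<close> is already
  \<open>3 * k\<close>. Otherwise \<open>u\<close> is 1 modulo \<open>k\<close> and 0 modulo 3,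
  matching the divisibility of \<open>dede\<close> by 3.\<close>

lemma dede_cong_mod_3k:
  assumes "0 < k" "coprime (h * m) k"
    and "3 dvd k \<Longrightarrow> u = 1"
    and "\<not> 3 dvd k \<Longrightarrow> [u = 1] (mod k) \<and> [u = 0] (mod 3)"
    and "[m * v = 1] (mod gcd 3 k * k)" "[h * h' = 1] (mod gcd 3 k * k)"
  shows "[dede (h * m) k = u * (h * m + v * h')] (mod 3 * k)"
proof -
  let ?H = "h * m"
  have "[(m * v) * (h * h') = 1 * 1] (mod gcd 3 k * k)"
    by (rule cong_mult[OF assms(5,6)])
  \<comment> \<open>Writing 1 as a product of the two inverse relations exposes a factor
    \<open>?H\<close> on the right, which is then cancelled.\<close>
  then have "[?H\<^sup>2 + ?H * (v * h') = ?H\<^sup>2 + 1] (mod gcd 3 k * k)"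
    by (intro cong_add cong_refl) (simp add: mult_ac)
  from cong_trans[OF dede_mult_cong[OF assms(2,1)] cong_sym[OF this]]
  have "[?H * dede ?H k = ?H * (?H + v * h')] (mod gcd 3 k * k)"
    by (simp only: distrib_left power2_eq_square)
  moreover have "coprime ?H (gcd 3 k * k)"
    using assms(2) by (metis coprime_mult_right_iff coprime_divisors dvd_refl gcd_dvd2)
  ultimately have base: "[dede ?H k = ?H + v * h'] (mod gcd 3 k * k)"
    by (simp only: cong_mult_lcancel)
  show ?thesis
  proof (cases "3 dvd k")
    case True
    then show ?thesis using base assms(3) by (simp add: gcd_proj1_if_dvd)
  next
    case False
    then have cop: "coprime 3 k" by (simp add: prime_imp_coprime)
    have "[1 * dede ?H k = u * (?H + v * h')] (mod k)"
      using base cop assms(4)[OF False] by (intro cong_mult) (auto simp: cong_sym)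
    moreover have "[dede ?H k = u * (?H + v * h')] (mod 3)"
      using three_dvd_dede[OF False, of ?H] assms(4)[OF False]
      by (auto simp: cong_0_iff cong_iff_dvd_diff)
    ultimately show ?thesis using coprime_cong_mult[OF _ _ cop] by simp
  qed
qed

text \<open>Multiplication by the odd \<open>H\<close> loses nothing modulo \<open>2 ^ l\<close>.
  Only the class of \<open>q\<close> modulo 4 matters, because \<open>4 * 6 * (g * k)\<close> is a
  multiple of \<open>8 * (g * k)\<close>.\<close>

lemma dede_cong_even:
  assumes "odd H" "0 < H" "0 < k" "coprime H k" "even k"
    and "2 ^ l dvd 8 * (g * k)" "[H * w = 1] (mod 2 ^ l)" "[q = H * jacobi k H] (mod 4)"
  shows "[g * dede H k = g * H + g * w * (k\<^sup>2 + 3 * k + 1) - 6 * (g * k) * q] (mod 2 ^ l)"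
proof -
  let ?J = "jacobi k H" and ?B = "k\<^sup>2 + 3 * k + 1"
  obtain x where x: "H * dede H k - (H\<^sup>2 + k\<^sup>2 + 3 * k + 1 + 2 * k * ?J) = 8 * k * x"
    using dede_mod_even[OF assms(1-4)] unfolding cong_iff_dvd_diff by (elim dvdE)
  obtain y where y: "q - H * ?J = 4 * y"
    using assms(8) unfolding cong_iff_dvd_diff by (elim dvdE)
  obtain z where z: "H * w - 1 = 2 ^ l * z"
    using assms(7) unfolding cong_iff_dvd_diff by (elim dvdE)
  obtain p where p: "H = 2 * p + 1" using assms(1) by (rule oddE)
  \<comment> \<open>As \<open>H\<close> is odd, \<open>1 + 3 * H\<^sup>2\<close> is divisible by 4.
    This trades the coefficient 2 of the symbol for the coefficient -6 wanted for quarter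
    turns.\<close>
  have J: "?J + 3 * q * H = 4 * (?J * (3 * p\<^sup>2 + 3 * p + 1) + 3 * y * H)"
  proof -
    have "q = H * ?J + 4 * y" using y by simp
    then show ?thesis by (simp add: p algebra_simps power2_eq_square)
  qed
  have "H * (g * dede H k - (g * H + g * w * ?B - 6 * (g * k) * q))
    = g * (H * dede H k - (H\<^sup>2 + k\<^sup>2 + 3 * k + 1 + 2 * k * ?J))
      - g * ?B * (H * w - 1) + 2 * (g * k) * (?J + 3 * q * H)"
    by (simp add: algebra_simps power2_eq_square)
  also have "\<dots> = 8 * (g * k) * (x + (?J * (3 * p\<^sup>2 + 3 * p + 1) + 3 * y * H)) - 2 ^ l * (z * (g * ?B))"
    unfolding x z J by (simp add: algebra_simps)
  also have "2 ^ l dvd \<dots>"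
    by (rule dvd_diff[OF dvd_mult2[OF assms(6)] dvd_triv_left])
  finally have "2 ^ l dvd H * (g * dede H k - (g * H + g * w * ?B - 6 * (g * k) * q))" .
  moreover have "coprime (2 ^ l) H" using assms(1) by simp
  ultimately show ?thesis by (simp add: coprime_dvd_mult_right_iff cong_iff_dvd_diff)
qed

text \<open>Recasts \<open>dede_mod_8\<close> as a multiple of \<open>- 6 * k\<close>, the shape of
  the last term for even moduli, so that both cases share one \<open>phase\<close>.\<close>

lemma dede_cong_odd:
  assumes "odd k" "0 < k" "coprime h k"
  shows "[dede h k = - 6 * k * ((k - 3) div 2 + jacobi (-1) k * jacobi h k)] (mod 8)"
proof -
  obtain p where p: "k = 2 * p + 1" using assms(1) by (rule oddE)
  have div: "(k - 3) div 2 = p - 1" unfolding p by simp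
  have J: "jacobi h k = 1 \<or> jacobi h k = -1" using jacobi_coprime assms by blast
  have "[k = 3] (mod 4) \<longleftrightarrow> odd p"
    unfolding p by (rule cong_3_mod_4_iff)
  then have "jacobi (-1) k = (if odd p then -1 else 1)"
    using jacobi_minus_one assms by simp
  then have "[k + 1 - 2 * jacobi h k = - 6 * k * (p - 1 + jacobi (-1) k * jacobi h k)] (mod 8)"
    using J unfolding p cong_iff_dvd_diff
    by (auto elim!: evenE oddE simp: algebra_simps)
  then show ?thesis
    unfolding div using dede_mod_8[OF assms] cong_trans by blast
qed

text \<open>The factor of one index in \<open>psi\<close>, with powers of -1 replaced by the residue
  conditions that reciprocity produces; it is 1 for odd \<open>k_sub k m\<close>.\<close>

definition psi_sign :: "int \<Rightarrow> int \<Rightarrow> int \<Rightarrow> int" where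
  "psi_sign k m h =
    (if even (k_sub k m) \<and> [k_odd k m = 1] (mod 4) \<and> \<not> [h * m_sub k m = 1] (mod 4) then -1 else 1) *
    (if even (k_sub k m) \<and> odd (lam_sub k m)
        \<and> \<not> ([h * m_sub k m = 1] (mod 8) \<or> [h * m_sub k m = 7] (mod 8)) then -1 else 1)"

text \<open>The exponent of \<open>\<i>\<close> due to one index, before weighting by
  \<open>\<delta> m\<close>. Only its class modulo 4 matters: it enters with factor
  \<open>6 * k\<close> modulo \<open>24 * k\<close>.\<close>

definition phase :: "int \<Rightarrow> int \<Rightarrow> int \<Rightarrow> int" where
  "phase k m h = (if odd (k_sub k m) then (k_sub k m - 3) div 2 else 0)
    + jacobi ((-1) ^ nat (k_sub k m) * m_sub k m) (k_odd k m)
      * (jacobi h (k_odd k m) * psi_sign k m h)"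

lemma gcd_k_sub: "gcd m k * k_sub k m = k"
  by (simp add: k_sub_def)

lemma gcd_m_sub: "gcd m k * m_sub k m = m"
  by (simp add: m_sub_def)

lemma k_sub_pos: "0 < k \<Longrightarrow> 0 < k_sub k m"
  by (simp add: k_sub_def pos_imp_zdiv_pos_iff zdvd_imp_le)

lemma coprime_m_sub_k_sub: "0 < k \<Longrightarrow> coprime (m_sub k m) (k_sub k m)"
  unfolding k_sub_def m_sub_def by (intro div_gcd_coprime) auto

lemma k_sub_decompose: "k_sub k m = 2 ^ lam_sub k m * k_odd k m"
  unfolding lam_sub_def k_odd_def by (simp add: multiplicity_dvd)

lemma k_odd_pos: "0 < k \<Longrightarrow> 0 < k_odd k m"
  using k_sub_decompose[of k m] k_sub_pos[of k m] by (simp add: zero_less_mult_iff)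

lemma odd_k_odd: "0 < k \<Longrightarrow> odd (k_odd k m)"
  unfolding lam_sub_def k_odd_def using k_sub_pos[of k m] multiplicity_decompose[of "k_sub k m" 2] by auto

lemma lam_sub_odd: "odd (k_sub k m) \<Longrightarrow> lam_sub k m = 0"
  by (simp add: lam_sub_def not_dvd_imp_multiplicity_0)

lemma k_odd_odd: "odd (k_sub k m) \<Longrightarrow> k_odd k m = k_sub k m"
  by (simp add: k_odd_def lam_sub_odd)

lemma coprime_k_sub: "coprime h k \<Longrightarrow> coprime h (k_sub k m)"
  using gcd_k_sub[of m k] by (metis coprime_mult_right_iff)

text \<open>Chinese remaindering over \<open>24 * k\<close>: modulo the part prime to 2 the pair
  \<open>t1\<close>, \<open>t2\<close> acts as 1, 0 and the phase term vanishes; modulo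
  \<open>2 ^ (3 + lam)\<close> it acts as 0, 1.\<close>

lemma dede_index_cong:
  fixes k m h :: int
  defines "g \<equiv> gcd m k" and "K \<equiv> k_sub k m" and "M \<equiv> m_sub k m"
  assumes "0 < k" "0 < m" "0 < h \<or> odd k" "coprime h k"
    and lam: "lam = multiplicity 2 k"
    and u: "3 dvd K \<Longrightarrow> u = 1" "\<not> 3 dvd K \<Longrightarrow> [u = 1] (mod K) \<and> [u = 0] (mod 3)"
    and v: "[M * v = 1] (mod gcd 3 K * K)"
    and w: "even K \<Longrightarrow> [M * w = 1] (mod 2 ^ (3 + lam))"
    and t1: "[t1 = 1] (mod (3 * k) div 2 ^ lam)" "[t1 = 0] (mod 2 ^ (3 + lam))"
    and t2: "[t2 = 1] (mod 2 ^ (3 + lam))" "[t2 = 0] (mod (3 * k) div 2 ^ lam)"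
    and h': "[h * h' = 1] (mod k ^ 4)"
  shows "[g * dede (h * M) K =
      t1 * (u * (m * h + g * v * h'))
      + t2 * (if even K then m * h + g * w * h' * (K\<^sup>2 + 3 * K + 1) else 0)
      - 6 * k * phase k m h] (mod 24 * k)"
    (is "[?L = t1 * ?A + t2 * ?B - ?C] (mod _)")
proof -
  define ko where "ko = k div 2 ^ lam"
  have gK: "g * K = k" and gM: "g * M = m"
    using gcd_k_sub gcd_m_sub by (simp_all add: g_def K_def M_def)
  have K: "0 < K" using k_sub_pos assms(4) by (simp add: K_def)
  have cop: "coprime (h * M) K"
    using coprime_m_sub_k_sub[OF \<open>0 < k\<close>] coprime_k_sub[OF assms(7)] by (simp add: K_def M_def)
  have k: "k = 2 ^ lam * ko"
    unfolding ko_def lam by (simp add: multiplicity_dvd)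
  have "odd ko"
    unfolding ko_def lam using multiplicity_decompose[of k 2] \<open>0 < k\<close> by auto
  have k3: "(3 * k) div 2 ^ lam = 3 * ko"
    unfolding k by simp
  have "K dvd k" using gK by (metis dvd_triv_right)

  have three: "[?L = ?A] (mod 3 * k)"
  proof -
    have "gcd 3 K * K dvd k * k"
      using \<open>K dvd k\<close> by (intro mult_dvd_mono) (meson dvd_trans gcd_dvd2)
    also have "\<dots> dvd k ^ 4"
      by (simp add: le_imp_power_dvd flip: power2_eq_square)
    finally have "[h * h' = 1] (mod gcd 3 K * K)" using h' cong_dvd_modulus by blast
    then have "[dede (h * M) K = u * (h * M + v * h')] (mod 3 * K)"
      using dede_cong_mod_3k[OF K cop u v] by simp
    then have "[g * dede (h * M) K = g * (u * (h * M + v * h'))] (mod g * (3 * K))"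
      by (rule cong_cmult_modulus)
    also have "g * (3 * K) = 3 * k" using gK by simp
    also have "g * (u * (h * M + v * h')) = u * (m * h + g * v * h')"
      unfolding gM[symmetric] by (simp add: algebra_simps)
    finally show ?thesis by simp
  qed

  have two: "[?L = ?B - ?C] (mod 2 ^ (3 + lam))"
  proof (cases "even K")
    case True
    then have "even k" using \<open>K dvd k\<close> by (meson dvd_trans)
    then have "odd h" "0 < h" using assms(6,7) by auto
    have "odd M" using cop True by auto
    have "0 < g" using \<open>0 < k\<close> by (simp add: g_def)
    then have "0 < M" using \<open>0 < m\<close> gM by (metis zero_less_mult_pos)
    have H: "odd (h * M)" "0 < h * M" using \<open>odd h\<close> \<open>odd M\<close> \<open>0 < h\<close> \<open>0 < M\<close> by auto
    have "2 ^ (3 + lam) dvd k ^ 4"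
    proof -
      have "2 ^ 3 * 2 ^ lam dvd k ^ 3 * k"
        using \<open>even k\<close> k by (intro mult_dvd_mono dvd_power_same) auto
      then show ?thesis by (simp add: power_add numeral_eq_Suc mult_ac)
    qed
    then have "[h * h' = 1] (mod 2 ^ (3 + lam))" using h' cong_dvd_modulus by blast
    then have "[(M * w) * (h * h') = 1 * 1] (mod 2 ^ (3 + lam))"
      using w True by (intro cong_mult) simp_all
    then have inv: "[h * M * (w * h') = 1] (mod 2 ^ (3 + lam))" by (simp add: mult_ac)
    have dvd: "2 ^ (3 + lam) dvd 8 * (g * K)"
      unfolding gK k by (simp add: power_add)
    have "[h * M * jacobi K (h * M) = jacobi (h * M) (k_odd k m) * psi_sign k m h] (mod 4)"
    proof -
      have "coprime (h * M) (k_odd k m)"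
        using cop k_sub_decompose[of k m] by (simp add: K_def)
      from jacobi_flip_mod_4[OF H odd_k_odd[OF \<open>0 < k\<close>] k_odd_pos[OF \<open>0 < k\<close>] this, of "lam_sub k m"]
      show ?thesis
        using True k_sub_decompose[of k m] by (simp add: psi_sign_def K_def M_def)
    qed
    moreover have "phase k m h = jacobi (h * M) (k_odd k m) * psi_sign k m h"
      using True K odd_k_odd[OF \<open>0 < k\<close>] k_odd_pos[OF \<open>0 < k\<close>]
      by (simp add: phase_def jacobi_mult_left minus_one_power_iff even_nat_iff K_def M_def)
    ultimately have q: "[phase k m h = h * M * jacobi K (h * M)] (mod 4)"
      by (metis cong_sym)
    have "[g * dede (h * M) K = g * (h * M) + g * (w * h') * (K\<^sup>2 + 3 * K + 1)
        - 6 * (g * K) * phase k m h] (mod 2 ^ (3 + lam))"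
      by (rule dede_cong_even[OF H K cop True dvd inv q])
    also have "g * (h * M) = m * h" unfolding gM[symmetric] by simp
    finally show ?thesis using True gK by (simp add: mult.assoc)
  next
    case False
    \<comment> \<open>For odd \<open>K\<close> the whole 2-part of \<open>k\<close> lies in
      \<open>g\<close>, so multiplying a congruence modulo 8 by \<open>g\<close> reaches
      \<open>2 ^ (3 + lam)\<close>.\<close>
    have "coprime (2 ^ lam) K" using False by simp
    then have "2 ^ lam dvd g"
      using k gK by (metis coprime_dvd_mult_left_iff dvd_triv_left)
    then have dvd: "2 ^ (3 + lam) dvd g * 8" by (simp add: power_add mult.commute)
    have ph: "phase k m h = (K - 3) div 2 + jacobi (-1) K * jacobi (h * M) K"
      using False K k_odd_odd[of k m] jacobi_mult_left[of K "-1" M] jacobi_mult_left[of K h M]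
      by (simp add: phase_def psi_sign_def even_nat_iff minus_one_power_iff K_def M_def)
    have "[dede (h * M) K = - 6 * K * phase k m h] (mod 8)"
      unfolding ph using dede_cong_odd[OF _ K cop] False by blast
    then have "[g * dede (h * M) K = g * (- 6 * K * phase k m h)] (mod g * 8)"
      by (rule cong_cmult_modulus)
    then have "[g * dede (h * M) K = g * (- 6 * K * phase k m h)] (mod 2 ^ (3 + lam))"
      using dvd cong_dvd_modulus by blast
    also have "g * (- 6 * K * phase k m h) = 0 - 6 * k * phase k m h"
      unfolding gK[symmetric] by simp
    finally show ?thesis using False by simp
  qed

  have c3: "[?L = t1 * ?A + t2 * ?B - ?C] (mod 3 * ko)"
  proof -
    have "3 * ko dvd 3 * k" unfolding k by simp
    note three' = cong_dvd_modulus[OF three this]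
    have "[?C = 0] (mod 3 * ko)"
      unfolding cong_iff_dvd_diff k by simp
    then have "[t1 * ?A + t2 * ?B - ?C = 1 * ?A + 0 * ?B - 0] (mod 3 * ko)"
      using t1(1) t2(2) unfolding k3 by (intro cong_diff cong_add cong_mult cong_refl)
    from cong_trans[OF three' cong_sym[OF this[unfolded mult_1 mult_zero_left add_0_right diff_zero]]]
    show ?thesis .
  qed
  have c2: "[?L = t1 * ?A + t2 * ?B - ?C] (mod 2 ^ (3 + lam))"
  proof -
    have "[t1 * ?A + t2 * ?B - ?C = 0 * ?A + 1 * ?B - ?C] (mod 2 ^ (3 + lam))"
      using t1(2) t2(1) by (intro cong_diff cong_add cong_mult cong_refl)
    from cong_trans[OF two cong_sym[OF this[unfolded mult_1 mult_zero_left add_0_left]]]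
    show ?thesis .
  qed
  have "coprime (3 * ko) (2 ^ (3 + lam))"
    using \<open>odd ko\<close> by simp
  note coprime_cong_mult[OF c3 c2 this]
  moreover have "3 * ko * 2 ^ (3 + lam) = 24 * k"
    unfolding k by (simp add: power_add)
  ultimately show ?thesis by (simp only:)
qed

section \<open>Assembling the roots of unity\<close>

lemma minus_one_powi: "(-1) powi n = (if even n then 1 else -1 :: complex)"
  by (simp add: power_int_minus_left)

lemma even_div_2_iff: "odd n \<Longrightarrow> even ((n - 1) div 2) \<longleftrightarrow> [n = 1] (mod 4)" for n :: int
proof -
  assume "odd n"
  then obtain p where "n = 2 * p + 1" by (rule oddE)
  then show ?thesis by (auto simp: cong_iff_dvd_diff elim!: evenE)
qed

lemma even_div_8_iff:
  fixes n :: int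
  assumes "odd n"
  shows "even ((n\<^sup>2 - 1) div 8) \<longleftrightarrow> [n = 1] (mod 8) \<or> [n = 7] (mod 8)"
proof -
  define a where "a = n div 8"
  have n: "n = 8 * a + n mod 8" by (simp add: a_def)
  \<comment> \<open>For \<open>r\<close> = 1, 3, 5, 7 the number \<open>s\<close> is 0, 1, 3, 6, and
    the quotient has the parity of \<open>s\<close>.\<close>
  have eq: "((8 * a + r)\<^sup>2 - 1) div 8 = 8 * a\<^sup>2 + 2 * a * r + s" if "r\<^sup>2 = 8 * s + 1" for r s
  proof -
    have "(8 * a + r)\<^sup>2 - 1 = 8 * (8 * a\<^sup>2 + 2 * a * r + s)"
      using that by (simp add: algebra_simps power2_eq_square)
    then show ?thesis by simp
  qed
  from odd_mod_8[OF assms] show ?thesis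
  proof (elim disjE)
    assume r: "n mod 8 = 1"
    then show ?thesis using n eq[of 1 0] by (simp add: cong_def)
  next
    assume r: "n mod 8 = 3"
    then show ?thesis using n eq[of 3 1] by (simp add: cong_def)
  next
    assume r: "n mod 8 = 5"
    then show ?thesis using n eq[of 5 3] by (simp add: cong_def)
  next
    assume r: "n mod 8 = 7"
    then show ?thesis using n eq[of 7 6] by (simp add: cong_def)
  qed
qed

lemma psi_eq_prod_psi_sign:
  assumes "finite M" "0 < k" "coprime h k"
  shows "psi M \<delta> k h = (\<Prod>m\<in>{m \<in> M. odd (\<delta> m)}. of_int (psi_sign k m h))"
proof -
  let ?A = "{m \<in> M. odd (\<delta> m)}"
  let ?P = "\<lambda>m. even (k_sub k m) \<and> [k_odd k m = 1] (mod 4)"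
  let ?Q = "\<lambda>m. even (k_sub k m) \<and> odd (lam_sub k m)"
  have fin: "finite ?A" using assms(1) by simp
  \<comment> \<open>Separating the condition on \<open>\<delta> m\<close> lets both products in
    \<open>psi\<close> run over one index set and merge factor by factor.\<close>
  have split: "{m \<in> M. odd (\<delta> m) \<and> R m} = {m \<in> ?A. R m}" for R by auto
  have "psi M \<delta> k h =
      (\<Prod>m\<in>?A. if ?P m then (-1) powi ((h * m_sub k m - 1) div 2) else 1) *
      (\<Prod>m\<in>?A. if ?Q m then (-1) powi (((h * m_sub k m)\<^sup>2 - 1) div 8) else 1)"
    unfolding psi_def split prod.inter_filter[OF fin] ..
  also have "\<dots> = (\<Prod>m\<in>?A. of_int (psi_sign k m h))"
    unfolding prod.distrib[symmetric]
  proof (rule prod.cong[OF refl])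
    fix m
    show "(if ?P m then (-1) powi ((h * m_sub k m - 1) div 2) else 1) *
      (if ?Q m then (-1) powi (((h * m_sub k m)\<^sup>2 - 1) div 8) else 1) = (of_int (psi_sign k m h) :: complex)"
    proof (cases "even (k_sub k m)")
      case True
      have "coprime (h * m_sub k m) (k_sub k m)"
        using coprime_m_sub_k_sub[OF assms(2)] coprime_k_sub[OF assms(3)] by simp
      then have odd: "odd (h * m_sub k m)" using True coprime_common_divisor[of _ _ 2] by auto
      show ?thesis
        using True unfolding psi_sign_def minus_one_powi even_div_2_iff[OF odd] even_div_8_iff[OF odd] by simp
    qed (simp add: psi_sign_def)
  qed
  finally show ?thesis .
qed

lemma psi_square: "(psi M \<delta> k h)\<^sup>2 = 1"
proof -
  have "((-1) powi n)\<^sup>2 = (1 :: complex)" for n :: int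
    by (simp add: minus_one_powi)
  then show ?thesis by (simp add: psi_def power_mult_distrib prod_power_distrib)
qed

text \<open>Flipping the sign of the odd \<open>j\<close> shifts the exponent by an even number,
  giving the sign \<open>(-1)\<close> to the power \<open>d\<close>. Hence only indices with odd
  \<open>\<delta> m\<close> enter \<open>chi\<close> and \<open>psi\<close>.\<close>

lemma i_powi_sign:
  fixes d b j e :: int
  assumes "odd j" "e = 1 \<or> e = -1"
  shows "\<i> powi (d * (b + j * e)) = \<i> powi (d * (b + j)) * (if odd d then of_int e else 1)"
proof (cases "e = 1")
  case False
  then have e: "e = -1" using assms(2) by simp
  have "d * (b + j * e) = d * (b + j) + 2 * (- (d * j))" by (simp add: e algebra_simps)
  then have "\<i> powi (d * (b + j * e)) = \<i> powi (d * (b + j)) * \<i> powi (2 * (- (d * j)))"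
    using power_int_add[of \<i> "d * (b + j)" "2 * (- (d * j))"] by simp
  also have "\<i> powi (2 * (- (d * j))) = (\<i> powi 2) powi (- (d * j))"
    by (rule power_int_mult)
  also have "(\<i> powi 2) powi (- (d * j)) = (if odd d then of_int e else 1)"
    using assms(1) by (simp add: minus_one_powi e)
  finally show ?thesis .
qed simp

lemma i_powi_sum: "finite A \<Longrightarrow> \<i> powi (\<Sum>x\<in>A. f x) = (\<Prod>x\<in>A. \<i> powi f x)"
  by (induction A rule: finite_induct) (simp_all add: power_int_add)

text \<open>Splits the total phase into its part independent of \<open>h\<close>, which is
  \<open>c_exp\<close>, and the signs depending on \<open>h\<close>, which form \<open>chi\<close>
  and \<open>psi\<close>.\<close>

lemma i_powi_phase:
  assumes "finite M" "0 < k" "coprime h k"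
  shows "\<i> powi (\<Sum>m\<in>M. \<delta> m * phase k m h)
    = \<i> powi c_exp M \<delta> k * (chi M \<delta> k h * psi M \<delta> k h)"
proof -
  define B where "B m = (if odd (k_sub k m) then (k_sub k m - 3) div 2 else 0)" for m
  define J where "J m = jacobi ((-1) ^ nat (k_sub k m) * m_sub k m) (k_odd k m)" for m
  define E where "E m = jacobi h (k_odd k m) * psi_sign k m h" for m
  have unit: "jacobi x (k_odd k m) = 1 \<or> jacobi x (k_odd k m) = -1" if "coprime x (k_sub k m)" for x m
    using that k_sub_decompose[of k m] odd_k_odd[OF assms(2), of m] k_odd_pos[OF assms(2), of m]
    by (intro jacobi_coprime) auto
  have "J m = 1 \<or> J m = -1" for m
    unfolding J_def using coprime_m_sub_k_sub[OF assms(2), of m]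
    by (intro unit) (simp add: minus_one_power_iff)
  then have J: "odd (J m)" for m by (metis even_minus odd_one)
  have E: "E m = 1 \<or> E m = -1" for m
    using unit[OF coprime_k_sub[OF assms(3)], of m] by (auto simp: E_def psi_sign_def)
  have "(\<Sum>m\<in>{m \<in> M. odd (k_sub k m)}. \<delta> m * (k_sub k m - 3))
      = (\<Sum>m\<in>{m \<in> M. odd (k_sub k m)}. 2 * (\<delta> m * B m))"
    by (rule sum.cong[OF refl]) (auto simp: B_def elim!: oddE)
  also have "\<dots> = 2 * (\<Sum>m\<in>M. \<delta> m * B m)"
    unfolding sum_distrib_left[symmetric] sum.inter_filter[OF assms(1)]
    by (intro arg_cong[of _ _ "(*) 2"] sum.cong) (auto simp: B_def)
  finally have c: "c_exp M \<delta> k = (\<Sum>m\<in>M. \<delta> m * (B m + J m))"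
    unfolding c_exp_def by (simp add: J_def distrib_left sum.distrib)
  have "\<i> powi (\<Sum>m\<in>M. \<delta> m * phase k m h) = (\<Prod>m\<in>M. \<i> powi (\<delta> m * (B m + J m * E m)))"
    unfolding i_powi_sum[OF assms(1)] by (simp add: phase_def B_def J_def E_def)
  also have "\<dots> = (\<Prod>m\<in>M. \<i> powi (\<delta> m * (B m + J m))) * (\<Prod>m\<in>M. if odd (\<delta> m) then of_int (E m) else 1)"
    unfolding prod.distrib[symmetric] by (intro prod.cong refl i_powi_sign J E)
  also have "(\<Prod>m\<in>M. if odd (\<delta> m) then of_int (E m) else 1) = chi M \<delta> k h * psi M \<delta> k h"
    unfolding prod.inter_filter[OF assms(1), symmetric] psi_eq_prod_psi_sign[OF assms] chi_def
    by (simp add: E_def prod.distrib)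
  finally show ?thesis unfolding c i_powi_sum[OF assms(1)] .
qed

section \<open>From integer congruences to exponentials\<close>

lemma i_powi_eq_cis: "\<i> powi n = cis (2 * pi * (of_int n / 4))"
proof -
  have "\<i> powi n = cis (pi / 2) powi n" by simp
  also have "\<dots> = cis (of_int n * (pi / 2))" by (rule cis_power_int)
  finally show ?thesis by (simp add: field_simps)
qed

lemma exp_eq_cis: "exp (2 * of_real pi * \<i> / of_int k * of_int x) = cis (2 * pi * (of_int x / of_int k))"
  unfolding cis_conv_exp by (simp add: field_simps)

lemma exp_minus_eq_cis: "exp (- 2 * of_real pi * \<i> * of_real (- x)) = cis (2 * pi * x)"
  unfolding cis_conv_exp by (simp add: mult_ac)

lemma exp_cong_mod:
  assumes "[x = y] (mod k)" "0 < k"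
  shows "exp (2 * of_real pi * \<i> / of_int k * of_int x) = exp (2 * of_real pi * \<i> / of_int k * of_int y)"
proof -
  obtain z where "x = y + k * z" using assms(1) by (metis cong_iff_lin cong_sym)
  then have "2 * pi * (of_int x / of_int k) = 2 * pi * (of_int y / of_int k) + 2 * pi * of_int z"
    using assms(2) by (simp add: field_simps)
  then show ?thesis unfolding exp_eq_cis by (simp flip: cis_mult)
qed

text \<open>Dividing \<open>E\<close> by \<open>24 * k\<close> turns \<open>6 * k * Q\<close> into
  quarter turns, the multiple \<open>24 * k * z\<close> into full turns, and the linear part into
  the Kloosterman exponent.\<close>

lemma hrr_summand:
  fixes h n a b h' E Q z k :: int
  assumes "finite M" "0 < k" "coprime h k"
    and E: "(\<Sum>m\<in>M. \<delta> m * (gcd m k * dede (h * m_sub k m) (k_sub k m)))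
      = - (24 * a * h + 24 * b * h') - 6 * k * Q + 24 * k * z"
  shows "exp (- 2 * of_real pi * \<i> * of_real (of_int (h * n) / of_int k
            + 1/2 * (\<Sum>m\<in>M. of_int (\<delta> m) * dedekind_sum ((m * h) div gcd m k) (k div gcd m k))))
    = \<i> powi Q * exp (2 * of_real pi * \<i> / of_int k * of_int ((a - n) * h + b * h'))"
proof -
  have D: "dedekind_sum ((m * h) div gcd m k) (k div gcd m k)
      = of_int (gcd m k * dede (h * m_sub k m) (k_sub k m)) / (12 * of_int k)" for m
  proof -
    have "(m * h) div gcd m k = h * m_sub k m"
      unfolding m_sub_def by (simp add: div_mult_swap mult.commute)
    moreover have "coprime (h * m_sub k m) (k_sub k m)"
      using coprime_m_sub_k_sub[OF assms(2)] coprime_k_sub[OF assms(3)] by simp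
    from dedekind_sum_eq[OF this k_sub_pos[OF assms(2)]]
    have "dedekind_sum (h * m_sub k m) (k_sub k m)
        = of_int (dede (h * m_sub k m) (k_sub k m)) / (12 * of_int (k_sub k m))"
      using k_sub_pos[OF assms(2), of m] by (simp add: field_simps)
    \<comment> \<open>Expanding the fraction by the gcd gives every index the common denominator
      \<open>12 * k\<close>.\<close>
    moreover have "of_int (dede (h * m_sub k m) (k_sub k m)) / (12 * of_int (k_sub k m))
        = of_int (gcd m k * dede (h * m_sub k m) (k_sub k m)) / (12 * real_of_int (gcd m k * k_sub k m))"
      using assms(2) by simp
    ultimately show ?thesis by (simp only: gcd_k_sub flip: k_sub_def)
  qed
  have "(\<Sum>m\<in>M. of_int (\<delta> m) * dedekind_sum ((m * h) div gcd m k) (k div gcd m k))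
      = of_int (\<Sum>m\<in>M. \<delta> m * (gcd m k * dede (h * m_sub k m) (k_sub k m))) / (12 * of_int k)"
    unfolding D by (simp add: sum_divide_distrib)
  note X = this[unfolded E]
  have "of_int (h * n) / of_int k
      + 1/2 * (\<Sum>m\<in>M. of_int (\<delta> m) * dedekind_sum ((m * h) div gcd m k) (k div gcd m k))
      = - (of_int Q / 4 + of_int ((a - n) * h + b * h') / of_int k - of_int z)"
    unfolding X using assms(2) by (simp add: field_simps)
  then have "exp (- 2 * of_real pi * \<i> * of_real (of_int (h * n) / of_int k
            + 1/2 * (\<Sum>m\<in>M. of_int (\<delta> m) * dedekind_sum ((m * h) div gcd m k) (k div gcd m k))))
      = cis (2 * pi * (of_int Q / 4 + of_int ((a - n) * h + b * h') / of_int k - of_int z))"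
    by (simp only: exp_minus_eq_cis)
  also have "\<dots> = cis (2 * pi * (of_int Q / 4)) * cis (2 * pi * (of_int ((a - n) * h + b * h') / of_int k))"
    by (simp add: cis_mult right_diff_distrib distrib_left flip: cis_divide)
  finally show ?thesis by (simp only: i_powi_eq_cis exp_eq_cis)
qed

lemma sum_index_coeffs:
  assumes "finite M"
  shows "(\<Sum>m\<in>M. \<delta> m * (t1 * (u m * (m * h + gcd m k * v m * h'))
      + t2 * (if even (k_sub k m)
          then m * h + gcd m k * w m * h' * ((k_sub k m)\<^sup>2 + 3 * k_sub k m + 1) else 0)
      - 6 * k * phase k m h))
    = - ((t1 * coeff_a1 M \<delta> u + t2 * coeff_a2 M \<delta> k) * h
        + (t1 * coeff_b1 M \<delta> k u v + t2 * coeff_b2 M \<delta> k w) * h')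
      - 6 * k * (\<Sum>m\<in>M. \<delta> m * phase k m h)"
proof -
  let ?c = "\<lambda>m. (k_sub k m)\<^sup>2 + 3 * k_sub k m + 1"
  have "(\<Sum>m\<in>M. \<delta> m * (t1 * (u m * (m * h + gcd m k * v m * h'))
      + t2 * (if even (k_sub k m) then m * h + gcd m k * w m * h' * ?c m else 0)
      - 6 * k * phase k m h))
    = (\<Sum>m\<in>M. t1 * h * (\<delta> m * u m * m) + t1 * h' * (\<delta> m * u m * v m * gcd m k)
      + t2 * h * (if even (k_sub k m) then \<delta> m * m else 0)
      + t2 * h' * (if even (k_sub k m) then \<delta> m * w m * gcd m k * ?c m else 0)
      - 6 * k * (\<delta> m * phase k m h))"
    by (rule sum.cong[OF refl]) (simp add: algebra_simps)
  also have "\<dots> = - t1 * h * coeff_a1 M \<delta> u - t1 * h' * coeff_b1 M \<delta> k u v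
      - t2 * h * coeff_a2 M \<delta> k - t2 * h' * coeff_b2 M \<delta> k w
      - 6 * k * (\<Sum>m\<in>M. \<delta> m * phase k m h)"
    unfolding coeff_a1_def coeff_b1_def coeff_a2_def coeff_b2_def sum.inter_filter[OF assms]
    by (simp add: sum.distrib sum_subtractf sum_distrib_left sum_negf)
  finally show ?thesis by (simp add: algebra_simps)
qed

section \<open>Divisibility by 24 and the final assembly\<close>

lemma twenty_four_dvd_iff: "8 dvd n \<Longrightarrow> 3 dvd n \<Longrightarrow> 24 dvd n" for n :: int
  by presburger

lemma twenty_four_dvd_coeff_a:
  assumes "\<And>m. m \<in> M \<Longrightarrow> 24 dvd m"
  shows "24 dvd t1 * coeff_a1 M \<delta> u + t2 * coeff_a2 M \<delta> k"
  unfolding coeff_a1_def coeff_a2_def using assms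
  by (intro dvd_add dvd_mult) (auto intro!: dvd_sum dvd_mult simp: dvd_minus_iff)

text \<open>A prime dividing \<open>k_sub k m\<close> cannot divide the coprime
  \<open>m_sub k m\<close>, so the full power of it in \<open>m\<close> sits in the gcd.\<close>

lemma dvd_gcd_index:
  assumes "0 < k" "prime p" "p dvd k_sub k m" "p ^ l dvd m"
  shows "p ^ l dvd gcd m k"
proof -
  have "coprime p (m_sub k m)"
    using coprime_m_sub_k_sub[OF assms(1), of m] assms(2,3)
    by (metis coprime_commute coprime_divisors dvd_refl)
  then have "coprime (p ^ l) (m_sub k m)" by simp
  moreover have "p ^ l dvd gcd m k * m_sub k m" using assms(4) by (simp add: gcd_m_sub)
  ultimately show ?thesis by (simp add: coprime_dvd_mult_left_iff)
qed

text \<open>Modulo 3 the second term dies with \<open>t2\<close>, and each summand of the first has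
  3 in \<open>u m\<close> or in the gcd. Modulo 8 the first dies with \<open>t1\<close>, and the
  second has 8 in the gcd.\<close>

lemma twenty_four_dvd_coeff_b:
  assumes "0 < k" "\<And>m. m \<in> M \<Longrightarrow> 24 dvd m"
    and "\<And>m. m \<in> M \<Longrightarrow> \<not> 3 dvd k_sub k m \<Longrightarrow> 3 dvd u m"
    and "8 dvd t1" "3 dvd t2"
  shows "24 dvd t1 * coeff_b1 M \<delta> k u v + t2 * coeff_b2 M \<delta> k w"
proof (rule twenty_four_dvd_iff)
  have "3 dvd u m * gcd m k" if "m \<in> M" for m
  proof (cases "3 dvd k_sub k m")
    case True
    have "3 dvd m" using assms(2)[OF that] by (rule dvd_trans[rotated]) simp
    then show ?thesis using dvd_gcd_index[OF assms(1) _ True, of 1] by simp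
  qed (use assms(3) that in auto)
  then have "3 dvd coeff_b1 M \<delta> k u v"
    unfolding coeff_b1_def dvd_minus_iff
    by (intro dvd_sum) (metis dvd_mult mult.assoc mult.commute)
  then show "3 dvd t1 * coeff_b1 M \<delta> k u v + t2 * coeff_b2 M \<delta> k w"
    using assms(5) by (intro dvd_add) auto
  have "8 dvd gcd m k" if "m \<in> M" "even (k_sub k m)" for m
  proof -
    have "8 dvd m" using assms(2)[OF that(1)] by (rule dvd_trans[rotated]) simp
    then show ?thesis using dvd_gcd_index[OF assms(1) _ that(2), of 3] by simp
  qed
  then have "8 dvd coeff_b2 M \<delta> k w"
    unfolding coeff_b2_def dvd_minus_iff by (intro dvd_sum dvd_mult2 dvd_mult) auto
  then show "8 dvd t1 * coeff_b1 M \<delta> k u v + t2 * coeff_b2 M \<delta> k w"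
    using assms(4) by (intro dvd_add) auto
qed

lemma twisted_kloosterman_eq:
  "twisted_kloosterman \<phi> a b k = (\<Sum>h\<in>reduced_residues k.
     \<phi> h * exp (2 * of_real pi * \<i> / of_int k * of_int (a * h + b * modular_inverse k h)))"
  unfolding twisted_kloosterman_def by (simp add: mult.commute)

theorem theorem4p5:
  fixes M :: "int set" and \<delta> u v w hinv :: "int \<Rightarrow> int"
    and k n t1 t2 a b :: int and lam :: nat
  assumes "finite M"
    and "\<And>m. m \<in> M \<Longrightarrow> 0 < m"
    and "\<And>m. m \<in> M \<Longrightarrow> 24 dvd m"
    and "0 < k"
    and "lam = multiplicity 2 k"
    and "\<And>m. m \<in> M \<Longrightarrow> 3 dvd k_sub k m \<Longrightarrow> u m = 1"
    and "\<And>m. m \<in> M \<Longrightarrow> \<not> 3 dvd k_sub k m \<Longrightarrow>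
           [u m = 1] (mod k_sub k m) \<and> [u m = 0] (mod 3)"
    and "\<And>m. m \<in> M \<Longrightarrow> [m_sub k m * v m = 1] (mod gcd 3 (k_sub k m) * k_sub k m)"
    and "\<And>m. m \<in> M \<Longrightarrow> even (k_sub k m) \<Longrightarrow> [m_sub k m * w m = 1] (mod 2 ^ (3 + lam))"
    and "[t1 = 1] (mod (3 * k) div 2 ^ lam)" and "[t1 = 0] (mod 2 ^ (3 + lam))"
    and "[t2 = 1] (mod 2 ^ (3 + lam))" and "[t2 = 0] (mod (3 * k) div 2 ^ lam)"
    and "a = (t1 * coeff_a1 M \<delta> u + t2 * coeff_a2 M \<delta> k) div 24"
    and "b = (t1 * coeff_b1 M \<delta> k u v + t2 * coeff_b2 M \<delta> k w) div 24"
    and "\<And>h. h \<in> reduced_residues k \<Longrightarrow> [h * hinv h = 1] (mod k)"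
  shows "24 dvd t1 * coeff_a1 M \<delta> u + t2 * coeff_a2 M \<delta> k \<and>
    24 dvd t1 * coeff_b1 M \<delta> k u v + t2 * coeff_b2 M \<delta> k w \<and>
    hrr_coeff M \<delta> k n =
      \<i> powi c_exp M \<delta> k * psi M \<delta> k 1 *
      (\<Sum>h\<in>reduced_residues k. chi M \<delta> k h * rho M \<delta> k h *
         exp (2 * of_real pi * \<i> / of_int k * of_int ((a - n) * h + b * hinv h))) \<and>
    hrr_coeff M \<delta> k n =
      \<i> powi c_exp M \<delta> k * psi M \<delta> k 1 *
      twisted_kloosterman (\<lambda>h. chi M \<delta> k h * rho M \<delta> k h) (a - n) b k"
proof -
  have a24: "24 dvd t1 * coeff_a1 M \<delta> u + t2 * coeff_a2 M \<delta> k"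
    by (rule twenty_four_dvd_coeff_a[OF assms(3)])
  have "(3 * k) div 2 ^ lam = 3 * (k div 2 ^ lam)"
    unfolding assms(5) by (simp add: div_mult_swap multiplicity_dvd)
  then have "3 dvd t2"
    using assms(13) by (metis cong_0_iff dvd_mult_left)
  have "(8::int) dvd 2 ^ (3 + lam)" by (simp add: power_add)
  then have "8 dvd t1"
    using assms(11) by (metis cong_0_iff dvd_trans)
  have b24: "24 dvd t1 * coeff_b1 M \<delta> k u v + t2 * coeff_b2 M \<delta> k w"
    using assms(7) by (intro twenty_four_dvd_coeff_b[OF assms(4,3) _ \<open>8 dvd t1\<close> \<open>3 dvd t2\<close>])
      (auto simp: cong_0_iff)
  have a: "24 * a = t1 * coeff_a1 M \<delta> u + t2 * coeff_a2 M \<delta> k"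
    and b: "24 * b = t1 * coeff_b1 M \<delta> k u v + t2 * coeff_b2 M \<delta> k w"
    using a24 b24 by (simp_all add: assms(14,15))
  \<comment> \<open>Proved for an arbitrary choice \<open>hi\<close> of inverses, so that it serves
    both \<open>hinv\<close> and \<open>modular_inverse\<close>.\<close>
  have main: "hrr_coeff M \<delta> k n = \<i> powi c_exp M \<delta> k * psi M \<delta> k 1 *
      (\<Sum>h\<in>reduced_residues k. chi M \<delta> k h * rho M \<delta> k h *
         exp (2 * of_real pi * \<i> / of_int k * of_int ((a - n) * h + b * hi h)))"
    if hi: "\<And>h. h \<in> reduced_residues k \<Longrightarrow> [h * hi h = 1] (mod k)" for hi
    unfolding hrr_coeff_def
  proof (rule trans[OF sum.cong[OF refl] sum_distrib_left[symmetric]])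
    fix h assume h: "h \<in> reduced_residues k"
    then have cop: "coprime h k" and h0: "0 \<le> h" by (simp_all add: reduced_residues_def)
    \<comment> \<open>Zero is a reduced residue only for \<open>k = 1\<close>, which is odd; for
      even \<open>k\<close> the reciprocity law gets a positive argument.\<close>
    have pos: "0 < h \<or> odd k"
    proof (cases "even k")
      case True
      then have "odd h" using cop coprime_common_divisor[of h k 2] by auto
      then show ?thesis using h0 by (cases "h = 0") auto
    qed simp
    \<comment> \<open>The index congruences need an inverse of \<open>h\<close> modulo \<open>3 k\<close> when \<open>3\<close> divides some \<open>k\<^sub>m\<close>
      and modulo \<open>8 k\<close> when some \<open>k\<^sub>m\<close> is even; a high power of \<open>k\<close> covers both cases.\<close>
    define h' where "h' = modular_inverse (k ^ 4) h"
    have h': "[h * h' = 1] (mod k ^ 4)"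
      unfolding h'_def using cop by (intro cong_modular_inverse1) simp
    define Q where "Q = (\<Sum>m\<in>M. \<delta> m * phase k m h)"
    have "[\<delta> m * (gcd m k * dede (h * m_sub k m) (k_sub k m)) =
        \<delta> m * (t1 * (u m * (m * h + gcd m k * v m * h'))
        + t2 * (if even (k_sub k m)
            then m * h + gcd m k * w m * h' * ((k_sub k m)\<^sup>2 + 3 * k_sub k m + 1) else 0)
        - 6 * k * phase k m h)] (mod 24 * k)" if "m \<in> M" for m
      by (rule cong_mult[OF cong_refl dede_index_cong[OF assms(4) assms(2)[OF that] pos cop assms(5)
            assms(6)[OF that] assms(7)[OF that] assms(8)[OF that] assms(9)[OF that] assms(10-13) h']])
    then have "[(\<Sum>m\<in>M. \<delta> m * (gcd m k * dede (h * m_sub k m) (k_sub k m)))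
        = - (24 * a * h + 24 * b * h') - 6 * k * Q] (mod 24 * k)"
      unfolding a b Q_def sum_index_coeffs[OF assms(1), symmetric] by (rule cong_sum)
    from cong_sym[OF this] obtain z where "(\<Sum>m\<in>M. \<delta> m * (gcd m k * dede (h * m_sub k m) (k_sub k m)))
        = - (24 * a * h + 24 * b * h') - 6 * k * Q + 24 * k * z"
      unfolding cong_iff_lin by (elim exE)
    note hrr_summand[OF assms(1,4) cop this, of n]
    also have "\<i> powi Q = \<i> powi c_exp M \<delta> k * (chi M \<delta> k h * psi M \<delta> k h)"
      unfolding Q_def by (rule i_powi_phase[OF assms(1,4) cop])
    \<comment> \<open>Inserting the square of \<open>psi M \<delta> k 1\<close>, which is 1,
      converts \<open>psi\<close> into \<open>rho\<close>.\<close>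
    also have "\<dots> = \<i> powi c_exp M \<delta> k * psi M \<delta> k 1 * (chi M \<delta> k h * rho M \<delta> k h)"
      using psi_square[of M \<delta> k 1] by (simp add: rho_def power2_eq_square mult_ac)
    also have "exp (2 * of_real pi * \<i> / of_int k * of_int ((a - n) * h + b * h'))
        = exp (2 * of_real pi * \<i> / of_int k * of_int ((a - n) * h + b * hi h))"
    proof (rule exp_cong_mod[OF _ assms(4)])
      \<comment> \<open>The exponential sees the inverse only modulo \<open>k\<close>, so the
        auxiliary inverse modulo \<open>k ^ 4\<close> may be replaced by
        \<open>hi h\<close>.\<close>
      have "[h * h' = 1] (mod k)" using h' by (rule cong_dvd_modulus) simp
      then have "[h * h' = h * hi h] (mod k)" using hi[OF h] cong_sym cong_trans by blast
      then have "[h' = hi h] (mod k)" using cop by (simp add: cong_mult_lcancel)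
      then show "[(a - n) * h + b * h' = (a - n) * h + b * hi h] (mod k)"
        by (intro cong_add cong_mult cong_refl)
    qed
    finally show "exp (- 2 * of_real pi * \<i> * of_real (of_int (h * n) / of_int k
            + 1/2 * (\<Sum>m\<in>M. of_int (\<delta> m) * dedekind_sum ((m * h) div gcd m k) (k div gcd m k))))
        = \<i> powi c_exp M \<delta> k * psi M \<delta> k 1 * (chi M \<delta> k h * rho M \<delta> k h *
         exp (2 * of_real pi * \<i> / of_int k * of_int ((a - n) * h + b * hi h)))"
      by (simp only: mult.assoc)
  qed
  have "[h * modular_inverse k h = 1] (mod k)" if "h \<in> reduced_residues k" for h
    using that by (intro cong_modular_inverse1) (simp add: reduced_residues_def)
  from main[OF this] main[OF assms(16)] show ?thesis
    using a24 b24 unfolding twisted_kloosterman_eq by blast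
qed

end
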